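(* (General one-fold/breather-like solution on a plane wave background.) Let $a_1,a_2,b_1,b_2$ belong to one of the classes $\Omega_1$ (with $a_2\ne0$), $\Omega_2,\Omega_3,\Omega_4$ of the context, let $z_1=\lambda_1^{-2}$, let $c_1,c_2,c_3$ be complex constants, and let $\kappa_i,\vartheta_i$ ($i=1,2,3$) be as in the context. Then the coupled Fokas–Lenells equation has the general solution $$u_s[1]=a_s\left(\frac{N_s^{[3]}}{M_1}\right)\mathrm e^{\mathrm i\omega_s},\quad s=1,2,\qquad M_1=\sum_{l,m=1}^3Z_{l,m}c_l^*c_m\mathrm e^{\vartheta_l^*+\vartheta_m},\quad N_s^{[3]}=\sum_{l,m=1}^3K_{l,m}^{[s]}c_mc_l^*\mathrm e^{\vartheta_m+\vartheta_l^*},$$ with the following coefficients. On $\Omega_1$: $Z_{l,m}=\frac{\kappa_l^*}{\kappa_m-\kappa_l^*}$ and $K^{[s]}_{l,m}=\frac{\kappa_l^*+b_1}{\kappa_m+b_1}\frac{\kappa_m}{\kappa_m-\kappa_l^*}$ if $1\le l,m\le2$, $l+m<4$; $Z_{2,2}=\frac{|z_1|^2((a_1^2+\sigma a_2^2)z_1-1)}{|z_1|^2-z_1^2}$, $K^{[s]}_{2,2}=\frac{z_1^2((a_1^2+\sigma a_2^2)z_1^*-1)}{|z_1|^2-z_1^2}$; $Z_{3,3}=K^{[s]}_{3,3}=\frac{(\sigma+a_2^2/a_1^2)|z_1|}{z_1^*-z_1}$; $K^{[1]}_{l,3}=-\frac{a_2}{a_1^2}\lambda_1$ and $K^{[2]}_{l,3}=\frac{\lambda_1}{a_2}$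 for $l=1,2$; all other entries are $0$. On $\Omega_2$: $Z_{l,m}=\frac{\kappa_l^*}{\kappa_m-\kappa_l^*}$ and $K^{[s]}_{l,m}=\frac{\kappa_l^*+b_1}{\kappa_m+b_1}\frac{\kappa_m}{\kappa_m-\kappa_l^*}$ if $1\le l,m\le2$; $Z_{3,3}=K^{[s]}_{3,3}=\frac{(\sigma+a_2^2/a_1^2)|z_1|}{z_1^*-z_1}$; $K^{[1]}_{l,3}=-\frac{a_2}{a_1^2}\lambda_1$ and $K^{[2]}_{l,3}=\frac{\lambda_1}{a_2}$ for $l=1,2$; all other entries are $0$. On $\Omega_3$: $Z_{3,3}=\frac{|z_1|^2((a_1^2+\sigma a_2^2)z_1-1)}{|z_1|^2-z_1^2}$, $K^{[s]}_{3,3}=\frac{z_1^2((a_1^2+\sigma a_2^2)z_1^*-1)}{|z_1|^2-z_1^2}$; otherwise $Z_{l,m}=\frac{\kappa_l^*}{\kappa_m-\kappa_l^*}$ and $K^{[s]}_{l,m}=\frac{\kappa_l^*+b_s}{\kappa_m+b_s}\frac{\kappa_m}{\kappa_m-\kappa_l^*}$. On $\Omega_4$: $Z_{l,m}=\frac{\kappa_l^*}{\kappa_m-\kappa_l^*}$ and $K^{[s]}_{l,m}=\frac{\kappa_l^*+b_s}{\kappa_m+b_s}\frac{\kappa_m}{\kappa_m-\kappa_l^*}$ for all $l,m$.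
   Context: Coupled Fokas–Lenells equation ($\sigma=\pm1$): $u_{1,xt}+u_1+\mathrm i(|u_1|^2+\tfrac12\sigma|u_2|^2)u_{1,x}+\tfrac{\mathrm i}{2}\sigma u_1u_2^*u_{2,x}=0$, $u_{2,xt}+u_2+\mathrm i(\sigma|u_2|^2+\tfrac12|u_1|^2)u_{2,x}+\tfrac{\mathrm i}{2}u_2u_1^*u_{1,x}=0$. Here $a_1,a_2$ are real, $b_1,b_2$ are nonzero reals, $\lambda_1\in\mathbb C\setminus(\mathbb R\cup\mathrm i\mathbb R)$. Classes: $\Omega_1$: $b_1=b_2$, $a_1\neq0$, $2b_1-(a_1^2+\sigma a_2^2)b_1^2=0$. $\Omega_2$: $b_1=b_2$, $a_1\ne0$, $2b_1-(a_1^2+\sigma a_2^2)b_1^2\ne0$. $\Omega_3$: $a_1,a_2\ne0$, $\sigma b_2=2a_2^{-2}-b_1a_1^2a_2^{-2}$. $\Omega_4$: $a_1,a_2\neq0$, $\sigma b_2\ne2a_2^{-2}-b_1a_1^2a_2^{-2}$, $b_1\ne b_2$. If $b_1=b_2$, then $\kappa_1,\kappa_2$ are the roots of $(\kappa/z_1-2)(\kappa+b_1)+(a_1^2+\sigma a_2^2)b_1^2=0$ and $\kappa_3=-b_1$; on $\Omega_1$, $\kappa_1=2z_1-b_1$, $\kappa_2=0$. If $b_1\ne b_2$ and $a_2\neq0$, then $\kappa_1,\kappa_2,\kappa_3$ are the roots of $(\kappa/z_1-2)(\kappa+b_1)(\kappa+b_2)+a_1^2b_1^2(\kappa+b_2)+\sigma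 a_2^2b_2^2(\kappa+b_1)=0$; on $\Omega_3$ (treated with this cubic), $\kappa_3=0$. Further $\vartheta_i=\mathrm i(\kappa_i-z_1)\big[x+\frac{z_1^*}{2b_1b_2|z_1|^2}(\kappa_i-z_1+b_1+b_2)t\big]$, $\omega_1=b_1x-\frac12\big(2a_1^2+\sigma a_2^2-\frac{2}{b_1}+\sigma a_2^2\frac{b_2}{b_1}\big)t$, $\omega_2=b_2x-\frac12\big(2\sigma a_2^2+a_1^2-\frac{2}{b_2}+a_1^2\frac{b_1}{b_2}\big)t$, and $^*$ is complex conjugation.
   Formalization: K^{[1]}_{l,3} is corrected to -(σa_2/a_1^2)λ_1 (printed sign fails for σ=-1); Ω_2 with a_1^2+σa_2^2=0 and Ω_3 with b_1=b_2 are excluded (zero denominators; the latter lies in Ω_1); on Ω_2 with a_2=0, a_2·(λ_1/a_2) is read as λ_1; the solution is on M_1≠0. *)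

theory Defs
  imports "HOL-Analysis.Analysis" "HOL-Computational_Algebra.Computational_Algebra"
begin

text \<open>
  Two-component quantities (\<open>u\<close>, \<open>a\<close>, \<open>b\<close>, \<open>\<omega>\<close>) are functions of \<open>s \<in> {1, 2}\<close>; the quantities
  \<open>c\<close>, \<open>\<kappa>\<close>, \<open>\<vartheta>\<close> are functions of \<open>i \<in> {1, 2, 3}\<close>.  Other index values are never used.
\<close>

definition cfl_solution_on ::
    "real \<Rightarrow> (real \<times> real) set \<Rightarrow> (nat \<Rightarrow> real \<Rightarrow> real \<Rightarrow> complex) \<Rightarrow> bool" where
  "cfl_solution_on \<sigma> U u \<longleftrightarrow> open U \<and>
     (\<exists>ux uxt :: nat \<Rightarrow> real \<Rightarrow> real \<Rightarrow> complex. \<forall>(x, t) \<in> U.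
        (\<forall>s \<in> {1, 2}.
           ((\<lambda>\<xi>. u s \<xi> t) has_vector_derivative ux s x t) (at x) \<and>
           ((\<lambda>\<tau>. ux s x \<tau>) has_vector_derivative uxt s x t) (at t)) \<and>
        uxt 1 x t + u 1 x t
          + \<i> * of_real ((cmod (u 1 x t))\<^sup>2 + 1/2 * \<sigma> * (cmod (u 2 x t))\<^sup>2) * ux 1 x t
          + \<i> / 2 * of_real \<sigma> * u 1 x t * cnj (u 2 x t) * ux 2 x t = 0 \<and>
        uxt 2 x t + u 2 x t
          + \<i> * of_real (\<sigma> * (cmod (u 2 x t))\<^sup>2 + 1/2 * (cmod (u 1 x t))\<^sup>2) * ux 2 x t
          + \<i> / 2 * u 2 x t * cnj (u 1 x t) * ux 1 x t = 0)"

datatype param_class = Omega1 | Omega2 | Omega3 | Omega4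

fun in_class :: "param_class \<Rightarrow> real \<Rightarrow> (nat \<Rightarrow> real) \<Rightarrow> (nat \<Rightarrow> real) \<Rightarrow> bool" where
  "in_class Omega1 \<sigma> a b \<longleftrightarrow>
     b 1 = b 2 \<and> a 1 \<noteq> 0 \<and> 2 * b 1 - ((a 1)\<^sup>2 + \<sigma> * (a 2)\<^sup>2) * (b 1)\<^sup>2 = 0"
| "in_class Omega2 \<sigma> a b \<longleftrightarrow>
     b 1 = b 2 \<and> a 1 \<noteq> 0 \<and> 2 * b 1 - ((a 1)\<^sup>2 + \<sigma> * (a 2)\<^sup>2) * (b 1)\<^sup>2 \<noteq> 0"
| "in_class Omega3 \<sigma> a b \<longleftrightarrow>
     a 1 \<noteq> 0 \<and> a 2 \<noteq> 0 \<and> \<sigma> * b 2 = 2 / (a 2)\<^sup>2 - b 1 * (a 1)\<^sup>2 / (a 2)\<^sup>2"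
| "in_class Omega4 \<sigma> a b \<longleftrightarrow>
     a 1 \<noteq> 0 \<and> a 2 \<noteq> 0 \<and> \<sigma> * b 2 \<noteq> 2 / (a 2)\<^sup>2 - b 1 * (a 1)\<^sup>2 / (a 2)\<^sup>2 \<and> b 1 \<noteq> b 2"

definition z1 :: "complex \<Rightarrow> complex" where
  "z1 lam = 1 / lam\<^sup>2"

definition quad_poly :: "real \<Rightarrow> (nat \<Rightarrow> real) \<Rightarrow> (nat \<Rightarrow> real) \<Rightarrow> complex \<Rightarrow> complex poly" where
  "quad_poly \<sigma> a b z =
     [:-2, 1 / z:] * [:of_real (b 1), 1:]
     + [:of_real (((a 1)\<^sup>2 + \<sigma> * (a 2)\<^sup>2) * (b 1)\<^sup>2):]"

definition cubic_poly :: "real \<Rightarrow> (nat \<Rightarrow> real) \<Rightarrow> (nat \<Rightarrow> real) \<Rightarrow> complex \<Rightarrow> complex poly" where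
  "cubic_poly \<sigma> a b z =
     [:-2, 1 / z:] * [:of_real (b 1), 1:] * [:of_real (b 2), 1:]
     + smult (of_real ((a 1)\<^sup>2 * (b 1)\<^sup>2)) [:of_real (b 2), 1:]
     + smult (of_real (\<sigma> * (a 2)\<^sup>2 * (b 2)\<^sup>2)) [:of_real (b 1), 1:]"

text \<open>\<open>proots\<close> is the multiset of roots, so a double root appears twice among the \<open>\<kappa> i\<close>.\<close>

definition admissible_kappa ::
    "param_class \<Rightarrow> real \<Rightarrow> (nat \<Rightarrow> real) \<Rightarrow> (nat \<Rightarrow> real) \<Rightarrow> complex \<Rightarrow> (nat \<Rightarrow> complex) \<Rightarrow> bool" where
  "admissible_kappa \<Omega> \<sigma> a b z \<kappa> \<longleftrightarrow>
     (b 1 = b 2 \<longrightarrow> proots (quad_poly \<sigma> a b z) = {#\<kappa> 1, \<kappa> 2#} \<and> \<kappa> 3 = - of_real (b 1)) \<and>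
     (b 1 \<noteq> b 2 \<and> a 2 \<noteq> 0 \<longrightarrow> proots (cubic_poly \<sigma> a b z) = {#\<kappa> 1, \<kappa> 2, \<kappa> 3#}) \<and>
     (\<Omega> = Omega1 \<longrightarrow> \<kappa> 1 = 2 * z - of_real (b 1) \<and> \<kappa> 2 = 0) \<and>
     (\<Omega> = Omega3 \<longrightarrow> \<kappa> 3 = 0)"

definition vartheta ::
    "(nat \<Rightarrow> real) \<Rightarrow> complex \<Rightarrow> (nat \<Rightarrow> complex) \<Rightarrow> nat \<Rightarrow> real \<Rightarrow> real \<Rightarrow> complex" where
  "vartheta b z \<kappa> i x t =
     \<i> * (\<kappa> i - z) *
       (of_real x + cnj z / of_real (2 * b 1 * b 2 * (cmod z)\<^sup>2)
                    * (\<kappa> i - z + of_real (b 1) + of_real (b 2)) * of_real t)"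

definition omega ::
    "real \<Rightarrow> (nat \<Rightarrow> real) \<Rightarrow> (nat \<Rightarrow> real) \<Rightarrow> nat \<Rightarrow> real \<Rightarrow> real \<Rightarrow> real" where
  "omega \<sigma> a b s x t =
     (if s = 1 then
        b 1 * x - 1/2 * (2 * (a 1)\<^sup>2 + \<sigma> * (a 2)\<^sup>2 - 2 / b 1 + \<sigma> * (a 2)\<^sup>2 * (b 2 / b 1)) * t
      else
        b 2 * x - 1/2 * (2 * \<sigma> * (a 2)\<^sup>2 + (a 1)\<^sup>2 - 2 / b 2 + (a 1)\<^sup>2 * (b 1 / b 2)) * t)"

text \<open>
  The denominators of \<open>Z_gen\<close> and \<open>K_gen\<close> vanish for some entries exactly when some root
  equals \<open>- b s\<close>.  This happens only on \<open>Omega2\<close> with \<open>(a 1)\<^sup>2 + \<sigma> * (a 2)\<^sup>2 = 0\<close> and, for the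
  roots of the cubic, on \<open>Omega3\<close> with \<open>b 1 = b 2\<close>; the latter parameters also lie in \<open>Omega1\<close>,
  whose formulas apply to them.
\<close>

definition Z_gen :: "(nat \<Rightarrow> complex) \<Rightarrow> nat \<Rightarrow> nat \<Rightarrow> complex" where
  "Z_gen \<kappa> l m = cnj (\<kappa> l) / (\<kappa> m - cnj (\<kappa> l))"

definition K_gen :: "(nat \<Rightarrow> real) \<Rightarrow> (nat \<Rightarrow> complex) \<Rightarrow> nat \<Rightarrow> nat \<Rightarrow> nat \<Rightarrow> complex" where
  "K_gen b \<kappa> s l m =
     (cnj (\<kappa> l) + of_real (b s)) / (\<kappa> m + of_real (b s)) * (\<kappa> m / (\<kappa> m - cnj (\<kappa> l)))"

definition Z_zero :: "real \<Rightarrow> (nat \<Rightarrow> real) \<Rightarrow> complex \<Rightarrow> complex" where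
  "Z_zero \<sigma> a z =
     of_real ((cmod z)\<^sup>2) * (of_real ((a 1)\<^sup>2 + \<sigma> * (a 2)\<^sup>2) * z - 1)
       / (of_real ((cmod z)\<^sup>2) - z\<^sup>2)"

definition K_zero :: "real \<Rightarrow> (nat \<Rightarrow> real) \<Rightarrow> complex \<Rightarrow> complex" where
  "K_zero \<sigma> a z =
     z\<^sup>2 * (of_real ((a 1)\<^sup>2 + \<sigma> * (a 2)\<^sup>2) * cnj z - 1) / (of_real ((cmod z)\<^sup>2) - z\<^sup>2)"

definition ZK_33 :: "real \<Rightarrow> (nat \<Rightarrow> real) \<Rightarrow> complex \<Rightarrow> complex" where
  "ZK_33 \<sigma> a z = of_real ((\<sigma> + (a 2)\<^sup>2 / (a 1)\<^sup>2) * cmod z) / (cnj z - z)"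

text \<open>
  For \<open>\<sigma> = 1\<close> the first component is the usual \<open>- a 2 / (a 1)\<^sup>2 * lam\<close>.  For \<open>\<sigma> = -1\<close> the
  sign \<open>\<sigma>\<close> is necessary: without it the \<open>u\<close> defined below does not solve the equation
  (for instance at \<open>a 1 = 1\<close>, \<open>a 2 = 2\<close>, \<open>b 1 = b 2 = 1\<close>, \<open>lam = 2 + \<i>\<close>, \<open>c = (1, 0, 1)\<close>).
\<close>

definition K_l3 :: "real \<Rightarrow> (nat \<Rightarrow> real) \<Rightarrow> complex \<Rightarrow> nat \<Rightarrow> complex" where
  "K_l3 \<sigma> a lam s =
     (if s = 1 then - of_real (\<sigma> * a 2 / (a 1)\<^sup>2) * lam else lam / of_real (a 2))"

fun Z_coeff ::
    "param_class \<Rightarrow> real \<Rightarrow> (nat \<Rightarrow> real) \<Rightarrow> complex \<Rightarrow> (nat \<Rightarrow> complex) \<Rightarrow> nat \<Rightarrow> nat \<Rightarrow> complex" where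
  "Z_coeff Omega1 \<sigma> a lam \<kappa> l m =
     (if l \<in> {1, 2} \<and> m \<in> {1, 2} \<and> l + m < 4 then Z_gen \<kappa> l m
      else if l = 2 \<and> m = 2 then Z_zero \<sigma> a (z1 lam)
      else if l = 3 \<and> m = 3 then ZK_33 \<sigma> a (z1 lam)
      else 0)"
| "Z_coeff Omega2 \<sigma> a lam \<kappa> l m =
     (if l \<in> {1, 2} \<and> m \<in> {1, 2} then Z_gen \<kappa> l m
      else if l = 3 \<and> m = 3 then ZK_33 \<sigma> a (z1 lam)
      else 0)"
| "Z_coeff Omega3 \<sigma> a lam \<kappa> l m =
     (if l = 3 \<and> m = 3 then Z_zero \<sigma> a (z1 lam) else Z_gen \<kappa> l m)"
| "Z_coeff Omega4 \<sigma> a lam \<kappa> l m = Z_gen \<kappa> l m"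

fun K_coeff ::
    "param_class \<Rightarrow> real \<Rightarrow> (nat \<Rightarrow> real) \<Rightarrow> (nat \<Rightarrow> real) \<Rightarrow> complex \<Rightarrow> (nat \<Rightarrow> complex)
      \<Rightarrow> nat \<Rightarrow> nat \<Rightarrow> nat \<Rightarrow> complex" where
  "K_coeff Omega1 \<sigma> a b lam \<kappa> s l m =
     (if l \<in> {1, 2} \<and> m \<in> {1, 2} \<and> l + m < 4 then K_gen b \<kappa> 1 l m
      else if l = 2 \<and> m = 2 then K_zero \<sigma> a (z1 lam)
      else if l = 3 \<and> m = 3 then ZK_33 \<sigma> a (z1 lam)
      else if l \<in> {1, 2} \<and> m = 3 then K_l3 \<sigma> a lam s
      else 0)"
| "K_coeff Omega2 \<sigma> a b lam \<kappa> s l m =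
     (if l \<in> {1, 2} \<and> m \<in> {1, 2} then K_gen b \<kappa> 1 l m
      else if l = 3 \<and> m = 3 then ZK_33 \<sigma> a (z1 lam)
      else if l \<in> {1, 2} \<and> m = 3 then K_l3 \<sigma> a lam s
      else 0)"
| "K_coeff Omega3 \<sigma> a b lam \<kappa> s l m =
     (if l = 3 \<and> m = 3 then K_zero \<sigma> a (z1 lam) else K_gen b \<kappa> s l m)"
| "K_coeff Omega4 \<sigma> a b lam \<kappa> s l m = K_gen b \<kappa> s l m"

definition M1 ::
    "param_class \<Rightarrow> real \<Rightarrow> (nat \<Rightarrow> real) \<Rightarrow> (nat \<Rightarrow> real) \<Rightarrow> complex \<Rightarrow> (nat \<Rightarrow> complex)
      \<Rightarrow> (nat \<Rightarrow> complex) \<Rightarrow> real \<Rightarrow> real \<Rightarrow> complex" where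
  "M1 \<Omega> \<sigma> a b lam \<kappa> c x t =
     (\<Sum>l\<in>{1..3}. \<Sum>m\<in>{1..3}. Z_coeff \<Omega> \<sigma> a lam \<kappa> l m * cnj (c l) * c m
        * exp (cnj (vartheta b (z1 lam) \<kappa> l x t) + vartheta b (z1 lam) \<kappa> m x t))"

definition N3 ::
    "param_class \<Rightarrow> real \<Rightarrow> (nat \<Rightarrow> real) \<Rightarrow> (nat \<Rightarrow> real) \<Rightarrow> complex \<Rightarrow> (nat \<Rightarrow> complex)
      \<Rightarrow> (nat \<Rightarrow> complex) \<Rightarrow> nat \<Rightarrow> real \<Rightarrow> real \<Rightarrow> complex" where
  "N3 \<Omega> \<sigma> a b lam \<kappa> c s x t =
     (\<Sum>l\<in>{1..3}. \<Sum>m\<in>{1..3}. K_coeff \<Omega> \<sigma> a b lam \<kappa> s l m * c m * cnj (c l)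
        * exp (vartheta b (z1 lam) \<kappa> m x t + cnj (vartheta b (z1 lam) \<kappa> l x t)))"

text \<open>
  The value \<open>a 2 = 0\<close> is allowed on \<open>Omega2\<close>.  There the entries \<open>lam / a 2\<close> of the second
  component only make sense in the product with the prefactor \<open>a 2\<close>: this product is \<open>lam\<close>,
  and \<open>a 2\<close> times any other entry is \<open>0\<close>.
\<close>

definition a_times_N3 ::
    "param_class \<Rightarrow> real \<Rightarrow> (nat \<Rightarrow> real) \<Rightarrow> (nat \<Rightarrow> real) \<Rightarrow> complex \<Rightarrow> (nat \<Rightarrow> complex)
      \<Rightarrow> (nat \<Rightarrow> complex) \<Rightarrow> nat \<Rightarrow> real \<Rightarrow> real \<Rightarrow> complex" where
  "a_times_N3 \<Omega> \<sigma> a b lam \<kappa> c s x t =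
     (if s = 2 \<and> a 2 = 0 then
        (\<Sum>l\<in>{1, 2}. lam * c 3 * cnj (c l)
           * exp (vartheta b (z1 lam) \<kappa> 3 x t + cnj (vartheta b (z1 lam) \<kappa> l x t)))
      else of_real (a s) * N3 \<Omega> \<sigma> a b lam \<kappa> c s x t)"

definition u1fold ::
    "param_class \<Rightarrow> real \<Rightarrow> (nat \<Rightarrow> real) \<Rightarrow> (nat \<Rightarrow> real) \<Rightarrow> complex \<Rightarrow> (nat \<Rightarrow> complex)
      \<Rightarrow> (nat \<Rightarrow> complex) \<Rightarrow> nat \<Rightarrow> real \<Rightarrow> real \<Rightarrow> complex" where
  "u1fold \<Omega> \<sigma> a b lam \<kappa> c s x t =
     a_times_N3 \<Omega> \<sigma> a b lam \<kappa> c s x t / M1 \<Omega> \<sigma> a b lam \<kappa> c x t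
       * exp (\<i> * of_real (omega \<sigma> a b s x t))"

lemma u1fold_eq:
  assumes "a 2 \<noteq> 0 \<or> s = 1"
  shows "u1fold \<Omega> \<sigma> a b lam \<kappa> c s x t =
     of_real (a s) * (N3 \<Omega> \<sigma> a b lam \<kappa> c s x t / M1 \<Omega> \<sigma> a b lam \<kappa> c x t)
       * exp (\<i> * of_real (omega \<sigma> a b s x t))"
  using assms by (auto simp: u1fold_def a_times_N3_def)

end

theory Submission
  imports Defs
begin

text \<open>
  A vector solution \<open>(p, v)\<close> of the Lax pair at \<open>\<lambda>\<close> over a solution \<open>u\<close> yields, by a Darboux
  transformation, the new solution \<open>u\<^sub>s + (\<lambda>\<^sup>*\<^sup>2 - \<lambda>\<^sup>2) v\<^sub>s p\<^sup>* / M\<close> with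
  \<open>M = \<lambda> |p|\<^sup>2 - \<lambda>\<^sup>* (|v\<^sub>1|\<^sup>2 + \<sigma> |v\<^sub>2|\<^sup>2)\<close>. Its \<open>x\<close>-derivative is a multiple of a simple expression
  that is linear in \<open>u\<^sub>x\<close> and \<open>v\<close>, so the equation reduces to three identities, the coefficients
  of \<open>u\<^sub>x\<close>, \<open>u\<close> and \<open>v\<close>.

  Over a plane wave the Lax pair has exponential solutions. A root \<open>\<kappa>\<close> of the characteristic
  equation \<open>\<kappa>/z - 2 + \<Sum>\<^sub>s \<sigma>\<^sub>s a\<^sub>s\<^sup>2 b\<^sub>s\<^sup>2 / (\<kappa> + b\<^sub>s) = 0\<close> gives \<open>p = 1\<close>,
  \<open>v\<^sub>s = a\<^sub>s b\<^sub>s / (\<lambda> (\<kappa> + b\<^sub>s))\<close>, and for \<open>b\<^sub>1 = b\<^sub>2\<close> there is one more with \<open>p = 0\<close>. Subtracting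
  the characteristic equations at \<open>\<kappa>\<^sub>m\<close> and \<open>\<kappa>\<^sub>l\<^sup>*\<close> evaluates the quadratic form \<open>M\<close> on two modes as
  a multiple of \<open>\<kappa>\<^sub>l\<^sup>* / (\<kappa>\<^sub>m - \<kappa>\<^sub>l\<^sup>*)\<close>. As \<open>z\<close> is not real, the denominator vanishes only if both
  roots are \<open>0\<close>, the case covered by the special entries on \<open>\<Omega>\<^sub>1\<close> and \<open>\<Omega>\<^sub>3\<close>.
\<close>

section \<open>Algebra of the Darboux transformation\<close>

text \<open>The letters \<open>S\<close>, \<open>A\<close>, \<open>Ac\<close>, \<open>G\<close>
  stand for the values of the Hermitian form on \<open>u\<close> and \<open>v\<close>. The two
  quotients are the logarithmic time derivatives of \<open>Mc\<close> and \<open>M\<close>, and the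
  bracket is the form at the transformed solution. The terms in \<open>A\<close> and
  \<open>Ac\<close> cancel outright; the rest is a polynomial identity.\<close>

lemma darboux_ux_coefficient:
  fixes l lc p pc A Ac G M Mc al S :: complex
  assumes "M \<noteq> 0" "Mc \<noteq> 0" 
   and M: "M = l*(p*pc) - lc*G" and Mc: "Mc = lc*(p*pc) - l*G" and al: "al = lc\<^sup>2 - l\<^sup>2"
  shows "(-(\<i>*al/4)*(lc*(p*pc)+l*G) + \<i>/2*al*p*Ac)/Mc - (-(\<i>*al/4)*(l*(p*pc)+lc*G) + \<i>/2*al*pc*A)/M
    + \<i>/2*(S + al/M*pc*A - al/Mc*p*Ac - al\<^sup>2*(p*pc)*G/(M*Mc)) = \<i>/2*S"
proof -
  have "(lc*(p*pc)+l*G)*M - (l*(p*pc)+lc*G)*Mc + 2*al*(p*pc)*G = 0"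
    unfolding M Mc al by algebra
  then show ?thesis using assms(1,2)
    by (simp add: divide_simps) algebra
qed

text \<open>Everything collapses to the two linear relations \<open>l*Mc - lc*M = al*G\<close> and
  \<open>lc*Mc - l*M = al*(p*pc)\<close>, which also govern the coefficient of
  \<open>v\<close>.\<close>

lemma darboux_u_coefficient:
  fixes l lc p pc A G M Mc al B C h :: complex
  assumes "M \<noteq> 0" "Mc \<noteq> 0" "lc \<noteq> 0"
   and M: "M = l*(p*pc) - lc*G" and Mc: "Mc = lc*(p*pc) - l*G" and al: "al = lc\<^sup>2 - l\<^sup>2"
   and h: "h = B - 2*\<i>*pc/lc"
  shows "- 1 - \<i>/2*C + al/(lc*M)*h*(-(\<i>/2)*(A-l*p)) + l*M/(lc*Mc)
   + \<i>/2*(C + al*A*h/(lc*M) - al/Mc*p*(B+al*G*h/(lc*M))) = 0"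
proof -
  have B: "B = h + 2*\<i>*pc/lc" using h by simp
  have 1: "l*Mc - lc*M - al*G = 0" "l*M+al*(p*pc)-lc*Mc = 0" unfolding M Mc al by algebra+
  have II: "\<i>*\<i> = -1" by simp
  have "- 1 - \<i>/2*C + al/(lc*M)*h*(-(\<i>/2)*(A-l*p)) + l*M/(lc*Mc)
   + \<i>/2*(C + al*A*h/(lc*M) - al/Mc*p*(B+al*G*h/(lc*M)))
    = \<i>/2*al*p*h*((l*Mc - lc*M - al*G)/(lc*M*Mc)) + (l*M+al*(p*pc)-lc*Mc)/(lc*Mc)"
    unfolding B using assms(1-3) apply (simp add: divide_simps) using II by algebra
  with 1 show ?thesis by simp
qed

lemma darboux_v_coefficient:
  fixes l lc p pc A G M Mc al B C h S :: complex
  assumes "M \<noteq> 0" "Mc \<noteq> 0" "lc \<noteq> 0"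
   and M: "M = l*(p*pc) - lc*G" and Mc: "Mc = lc*(p*pc) - l*G" and al: "al = lc\<^sup>2 - l\<^sup>2"
   and h: "h = B - 2*\<i>*pc/lc"
  shows "al/(lc*M)*(-(\<i>/4)*l\<^sup>2*h + \<i>/2*S*h + (\<i>/4*lc\<^sup>2*(B+2*\<i>*pc/lc) - \<i>/2*lc*pc*C - \<i>/2*S*h)
       - h*(-(\<i>*al/4)*(l*(p*pc)+lc*G) + \<i>/2*al*pc*A)/M)
   + l/(lc*Mc)*al*pc + \<i>/2*(al*pc/M)*(C + al*A*h/(lc*M) - al/Mc*p*(B+al*G*h/(lc*M))) = 0"
proof -
  have B: "B = h + 2*\<i>*pc/lc" using h by simp
  have II: "\<i>*\<i> = -1" by simp
  have 1: "l*Mc - lc*M - al*G = 0" "l*M+al*(p*pc)-lc*Mc = 0" "M+(l*(p*pc)+lc*G)-2*l*(p*pc)=0" unfolding M Mc al by algebra+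
  have 2: "-(\<i>/4)*l\<^sup>2*h + \<i>/2*S*h + (\<i>/4*lc\<^sup>2*(B+2*\<i>*pc/lc) - \<i>/2*lc*pc*C - \<i>/2*S*h)
    = \<i>/4*al*h - lc*pc - \<i>/2*lc*pc*C"
    unfolding B al using assms(3) apply (simp add: divide_simps power2_eq_square) using II by algebra
  have "al/(lc*M)*(\<i>/4*al*h - lc*pc - \<i>/2*lc*pc*C
       - h*(-(\<i>*al/4)*(l*(p*pc)+lc*G) + \<i>/2*al*pc*A)/M)
   + l/(lc*Mc)*al*pc + \<i>/2*(al*pc/M)*(C + al*A*h/(lc*M) - al/Mc*p*(B+al*G*h/(lc*M))) =
    al/(lc*M)*(\<i>*al/4*h*((M+(l*(p*pc)+lc*G)-2*l*(p*pc))/M + 2*(p*pc)*(l*Mc - lc*M - al*G)/(M*Mc)) + pc/Mc*(l*M+al*(p*pc)-lc*Mc))"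
    unfolding B using assms(1-3) apply (simp add: divide_simps) using II by algebra
  then show ?thesis unfolding 1 2 by simp
qed

section \<open>The indefinite Hermitian form and derivative rules\<close>

lemma has_vector_derivative_cdivide:
  fixes f g :: "real \<Rightarrow> complex"
  assumes "(f has_vector_derivative f') (at x)" "(g has_vector_derivative g') (at x)" "g x \<noteq> 0"
  shows "((\<lambda>x. f x / g x) has_vector_derivative (f' * g x - f x * g') / (g x)\<^sup>2) (at x)"
proof -
  have "((\<lambda>y. inverse (g y)) has_vector_derivative - g' / (g x)\<^sup>2) (at x)"
    using Deriv.has_derivative_inverse[OF assms(3) assms(2)[unfolded has_vector_derivative_def]] assms(3)
    by (simp add: has_vector_derivative_def power2_eq_square scaleR_conv_of_real field_simps)
  from has_vector_derivative_mult[OF assms(1) this] show ?thesis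
    using assms(3) by (simp add: field_simps power2_eq_square)
qed

text \<open>With this form both equations of the system take the common shape \<open>u_xt = - u -
  \<i>/2 * (herm \<sigma> u u * u_x + herm \<sigma> u u_x * u)\<close>.\<close>

definition herm :: "real \<Rightarrow> (nat \<Rightarrow> complex) \<Rightarrow> (nat \<Rightarrow> complex) \<Rightarrow> complex" where
  "herm \<sigma> f g = cnj (f 1) * g 1 + of_real \<sigma> * cnj (f 2) * g 2"

lemma cnj_herm: "cnj (herm \<sigma> f g) = herm \<sigma> g f"
  by (simp add: herm_def)

text \<open>The quotient rule for the transformed solution. The coefficient of \<open>ux\<close>
  collapses by \<open>M + al*(p*pc)/l = lc/l*Mc\<close>, and \<open>h\<close> is the factor left
  over in the terms with \<open>v\<close>.\<close>

lemma darboux_x_derivative: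
 fixes l lc p pc G M Mc M' al B u ux v h :: complex
 assumes "M \<noteq> 0" "l \<noteq> 0" "lc \<noteq> 0"
  and M: "M = l * (p * pc) - lc * G" and Mc: "Mc = lc * (p * pc) - l * G" and al: "al = lc\<^sup>2 - l\<^sup>2"
  and M': "M' = - al / (l * lc) * (p * B - \<i> * (l * (p * pc)+lc * G)/(l * lc))"
  and h: "h = B - 2 * \<i> * pc/lc"
 shows "((ux * M + u * M' + al * ((-(\<i>/l\<^sup>2) * v + p/l * ux) * pc + v * (-(\<i>/lc\<^sup>2) * pc + B/lc))) * M - (u * M+al * v * pc) * M')/M\<^sup>2
  = lc/l * (Mc/M) * (ux + al/(lc * M) * v * h)"
proof -
 have 1: "M + al * (p * pc)/l = lc/l * Mc" unfolding M Mc al using assms(2) by (simp add: field_simps power2_eq_square)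
 have 2: "al * (((-(\<i>/l\<^sup>2) * v) * pc + v * (-(\<i>/lc\<^sup>2) * pc + B/lc)) * M - v * pc * M') = al/l * Mc * v * h"
  unfolding M Mc al h M' using assms(2,3) apply (simp add: divide_simps power2_eq_square) by algebra
 have "((ux * M + u * M' + al * ((-(\<i>/l\<^sup>2) * v + p/l * ux) * pc + v * (-(\<i>/lc\<^sup>2) * pc + B/lc))) * M - (u * M+al * v * pc) * M')
  = ux * M * (M + al * (p * pc)/l) + al * (((-(\<i>/l\<^sup>2) * v) * pc + v * (-(\<i>/lc\<^sup>2) * pc + B/lc)) * M - v * pc * M')"
  using assms(1-3) by (simp add: algebra_simps)
  also have "\<dots> = lc/l * Mc * M * ux + al/l * Mc * v * h"
    unfolding 1 2 by (simp add: algebra_simps)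
  finally show ?thesis using assms(1-3) by (simp only:) (simp add: field_simps power2_eq_square)
qed

lemma has_vector_derivative_herm:
  assumes "\<And>s. s \<in> {1, 2} \<Longrightarrow> ((\<lambda>y. f y s) has_vector_derivative f' s) (at x)"
    and "\<And>s. s \<in> {1, 2} \<Longrightarrow> ((\<lambda>y. g y s) has_vector_derivative g' s) (at x)"
  shows "((\<lambda>y. herm \<sigma> (f y) (g y)) has_vector_derivative
      herm \<sigma> f' (g x) + herm \<sigma> (f x) g') (at x)"
proof -
  have 1: "((\<lambda>y. f y 1) has_vector_derivative f' 1) (at x)" "((\<lambda>y. f y 2) has_vector_derivative f' 2) (at x)"
    "((\<lambda>y. g y 1) has_vector_derivative g' 1) (at x)" "((\<lambda>y. g y 2) has_vector_derivative g' 2) (at x)"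
    by (rule assms; simp)+
  show ?thesis
    unfolding herm_def
    by (rule has_vector_derivative_eq_rhs) (rule derivative_intros 1 | simp add: algebra_simps)+
qed

lemma herm_linear:
  "herm \<sigma> (\<lambda>s. a * f s + b * g s) k = cnj a * herm \<sigma> f k + cnj b * herm \<sigma> g k"
  "herm \<sigma> k (\<lambda>s. a * f s + b * g s) = a * herm \<sigma> k f + b * herm \<sigma> k g"
  by (simp_all add: herm_def algebra_simps)

section \<open>Darboux transformation of a Lax eigenfunction\<close>

text \<open>
  \<open>(p, v)\<close> is a vector solution \<open>\<Phi>\<close> of the Lax pair
  \<open>\<Phi>\<^sub>x = (\<i> \<lambda>\<^sup>-\<^sup>2 \<Sigma> + \<lambda>\<^sup>-\<^sup>1 Q\<^sub>x) \<Phi>\<close>,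
  \<open>\<Phi>\<^sub>t = (\<i>/4 \<lambda>\<^sup>2 \<Sigma> + \<i>/2 \<Sigma> (Q\<^sup>2 - \<lambda> Q)) \<Phi>\<close> with \<open>\<Sigma> = diag(1, -1, -1)\<close> and \<open>Q\<close> off-diagonal with
  blocks \<open>(u\<^sub>1\<^sup>*, \<sigma> u\<^sub>2\<^sup>*)\<close> and \<open>(u\<^sub>1, u\<^sub>2)\<close>; its compatibility condition is the coupled
  Fokas--Lenells equation, which appears here as \<open>ux_t\<close>.
\<close>

locale lax_eigenfunction =
  fixes \<sigma> :: real and lam :: complex and u ux v :: "real \<Rightarrow> real \<Rightarrow> nat \<Rightarrow> complex"
    and p :: "real \<Rightarrow> real \<Rightarrow> complex"
  assumes lam: "lam \<noteq> 0"
    and u_x: "s \<in> {1, 2} \<Longrightarrow> ((\<lambda>\<xi>. u \<xi> t s) has_vector_derivative ux x t s) (at x)"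
    and ux_t: "s \<in> {1, 2} \<Longrightarrow> ((\<lambda>\<tau>. ux x \<tau> s) has_vector_derivative
        (- 1 - \<i>/2 * herm \<sigma> (u x t) (ux x t)) * u x t s
        + (- (\<i>/2) * herm \<sigma> (u x t) (u x t)) * ux x t s) (at t)"
    and p_x: "((\<lambda>\<xi>. p \<xi> t) has_vector_derivative
        \<i> / lam\<^sup>2 * p x t + herm \<sigma> (ux x t) (v x t) / lam) (at x)"
    and v_x: "s \<in> {1, 2} \<Longrightarrow> ((\<lambda>\<xi>. v \<xi> t s) has_vector_derivative
        - (\<i> / lam\<^sup>2) * v x t s + p x t / lam * ux x t s) (at x)"
    and p_t: "((\<lambda>\<tau>. p x \<tau>) has_vector_derivative
        \<i>/4 * lam\<^sup>2 * p x t + \<i>/2 * (herm \<sigma> (u x t) (u x t) * p x t - lam * herm \<sigma> (u x t) (v x t))) (at t)"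
    and v_t: "s \<in> {1, 2} \<Longrightarrow> ((\<lambda>\<tau>. v x \<tau> s) has_vector_derivative
        (- (\<i>/4) * lam\<^sup>2) * v x t s + (- (\<i>/2) * (herm \<sigma> (u x t) (v x t) - lam * p x t)) * u x t s) (at t)"
begin

abbreviation "lamc \<equiv> cnj lam"

definition "al = lamc\<^sup>2 - lam\<^sup>2"

definition M :: "real \<Rightarrow> real \<Rightarrow> complex" where
  "M x t = lam * (p x t * cnj (p x t)) - lamc * herm \<sigma> (v x t) (v x t)"

definition w :: "real \<Rightarrow> real \<Rightarrow> nat \<Rightarrow> complex" where
  "w x t s = (u x t s * M x t + al * v x t s * cnj (p x t)) / M x t"

text \<open>Dictated by the \<open>x\<close>-derivative of \<open>w\<close>: that derivative is a
  scalar multiple of \<open>y\<close>, in which \<open>h\<close> is the factor that depends on the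
  \<open>x\<close>-derivative of the seed.\<close>

definition h :: "real \<Rightarrow> real \<Rightarrow> complex" where
  "h x t = herm \<sigma> (v x t) (ux x t) - 2 * \<i> * cnj (p x t) / lamc"

definition y :: "real \<Rightarrow> real \<Rightarrow> nat \<Rightarrow> complex" where
  "y x t s = ux x t s + al / (lamc * M x t) * v x t s * h x t"

definition wx :: "real \<Rightarrow> real \<Rightarrow> nat \<Rightarrow> complex" where
  "wx x t s = lamc / lam * (cnj (M x t) / M x t) * y x t s"

lemma cnj_al: "cnj al = - al"
  by (simp add: al_def)

lemma cnj_M: "cnj (M x t) = lamc * (p x t * cnj (p x t)) - lam * herm \<sigma> (v x t) (v x t)"
  by (simp add: M_def cnj_herm mult.commute)

text \<open>The terms in \<open>herm \<sigma> ux v\<close> coming from \<open>p\<close> and from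
  \<open>v\<close> cancel, so only the conjugate product survives, as
  \<open>darboux_x_derivative\<close> requires.\<close>

lemma M_x:
  "((\<lambda>\<xi>. M \<xi> t) has_vector_derivative - al / (lam * lamc) * (p x t * herm \<sigma> (v x t) (ux x t)
      - \<i> * (lam * (p x t * cnj (p x t)) + lamc * herm \<sigma> (v x t) (v x t)) / (lam * lamc))) (at x)"
  unfolding M_def
  apply (rule has_vector_derivative_eq_rhs)
   apply (rule derivative_intros has_vector_derivative_herm p_x v_x | assumption)+
  apply (simp only: herm_linear)
  using lam apply (simp add: cnj_herm al_def divide_simps power2_eq_square)
  apply algebra
  done

text \<open>Here the terms in \<open>herm \<sigma> u u\<close> and in
  \<open>herm \<sigma> v u\<close> cancel.\<close>

lemma M_t:
  "((\<lambda>\<tau>. M x \<tau>) has_vector_derivative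
      - (\<i> * al / 4) * (lam * (p x t * cnj (p x t)) + lamc * herm \<sigma> (v x t) (v x t))
      + \<i>/2 * al * cnj (p x t) * herm \<sigma> (u x t) (v x t)) (at t)"
  unfolding M_def
  apply (rule has_vector_derivative_eq_rhs)
   apply (rule derivative_intros has_vector_derivative_herm p_t v_t | assumption)+
  apply (simp only: herm_linear)
  using lam apply (simp add: cnj_herm al_def divide_simps power2_eq_square)
  apply algebra
  done

lemma h_t:
  "((\<lambda>\<tau>. h x \<tau>) has_vector_derivative
      \<i>/4 * lamc\<^sup>2 * (herm \<sigma> (v x t) (ux x t) + 2 * \<i> * cnj (p x t) / lamc)
      - \<i>/2 * lamc * cnj (p x t) * herm \<sigma> (u x t) (ux x t)
      - \<i>/2 * herm \<sigma> (u x t) (u x t) * h x t) (at t)"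
proof -
  have II: "\<i> * \<i> = -1" by simp
  show ?thesis
  unfolding h_def
  apply (rule has_vector_derivative_eq_rhs)
   apply (rule derivative_intros has_vector_derivative_herm p_t v_t ux_t | assumption)+
  apply (simp only: herm_linear)
  using lam apply (simp add: cnj_herm divide_simps power2_eq_square)
  using II apply algebra
  done
qed

lemma w_x:
  assumes "M x t \<noteq> 0" "s \<in> {1, 2}"
  shows "((\<lambda>\<xi>. w \<xi> t s) has_vector_derivative wx x t s) (at x)"
proof -
  let ?p = "p x t" and ?B = "herm \<sigma> (v x t) (ux x t)" and ?G = "herm \<sigma> (v x t) (v x t)"
  have pc: "((\<lambda>\<xi>. cnj (p \<xi> t)) has_vector_derivative - (\<i> / lamc\<^sup>2) * cnj ?p + ?B / lamc) (at x)"
    by (rule has_vector_derivative_eq_rhs, (rule derivative_intros p_x)+) (simp add: cnj_herm)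
  show ?thesis
    unfolding w_def wx_def y_def
    apply (rule has_vector_derivative_eq_rhs)
     apply (rule has_vector_derivative_cdivide)
       apply (rule pc u_x v_x M_x assms derivative_intros)+
    using darboux_x_derivative[OF assms(1) lam _ M_def cnj_M al_def refl h_def, of "ux x t s" "u x t s" "v x t s"] lam
    apply (simp add: algebra_simps)
    done
qed

lemma wx_t:
  assumes Mn: "M x t \<noteq> 0" and s: "s \<in> {1, 2}"
  shows "((\<lambda>\<tau>. wx x \<tau> s) has_vector_derivative
    - w x t s - \<i>/2 * (herm \<sigma> (w x t) (w x t) * wx x t s + w x t s * herm \<sigma> (w x t) (wx x t))) (at t)"
proof -
  define pp S A Ac B C G where "pp = p x t" and S: "S = herm \<sigma> (u x t) (u x t)"
    and A: "A = herm \<sigma> (u x t) (v x t)" and Ac: "Ac = herm \<sigma> (v x t) (u x t)"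
    and B: "B = herm \<sigma> (v x t) (ux x t)" and C: "C = herm \<sigma> (u x t) (ux x t)"
    and G: "G = herm \<sigma> (v x t) (v x t)"
  define m mc hh where m: "m = M x t" and mc: "mc = cnj (M x t)" and hh: "hh = h x t"
  note names = pp_def[symmetric] S[symmetric] A[symmetric] Ac[symmetric] B[symmetric] C[symmetric] G[symmetric]
    m[symmetric] mc[symmetric] hh[symmetric] mc[folded m, symmetric]
  have nz: "m \<noteq> 0" "mc \<noteq> 0" "lamc \<noteq> 0" "lam \<noteq> 0"
    using Mn lam by (auto simp: m mc)
  have m_eq: "m = lam * (pp * cnj pp) - lamc * G" and mc_eq: "mc = lamc * (pp * cnj pp) - lam * G"
    unfolding mc cnj_M unfolding m M_def pp_def G by (rule refl)+
  have hh_eq: "hh = B - 2 * \<i> * cnj pp / lamc"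
    by (simp add: hh h_def names)
  define mt where "mt = - (\<i> * al / 4) * (lam * (pp * cnj pp) + lamc * G) + \<i>/2 * al * cnj pp * A"
  define mct where "mct = - (\<i> * al / 4) * (lamc * (pp * cnj pp) + lam * G) + \<i>/2 * al * pp * Ac"
  define ht where "ht = \<i>/4 * lamc\<^sup>2 * (B + 2 * \<i> * cnj pp / lamc) - \<i>/2 * lamc * cnj pp * C - \<i>/2 * S * hh"
  define us vs uxs where "us = u x t s" and "vs = v x t s" and "uxs = ux x t s"
  define ys where "ys = uxs + al / (lamc * m) * vs * hh"
  define Wy where "Wy = C + al * A * hh / (lamc * m) - al / mc * pp * (B + al * G * hh / (lamc * m))"
  define WW where "WW = S + al / m * cnj pp * A - al / mc * pp * Ac - al\<^sup>2 * (pp * cnj pp) * G / (m * mc)"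
  define k where "k = lamc / lam * (mc / m)"
  have mt: "((\<lambda>\<tau>. M x \<tau>) has_vector_derivative mt) (at t)"
    using M_t[of x t] by (simp add: mt_def names)
  have mct: "((\<lambda>\<tau>. cnj (M x \<tau>)) has_vector_derivative mct) (at t)"
    by (rule has_vector_derivative_eq_rhs, (rule derivative_intros mt)+)
       (simp add: mt_def mct_def cnj_al G A Ac cnj_herm algebra_simps)
  have ht: "((\<lambda>\<tau>. h x \<tau>) has_vector_derivative ht) (at t)"
    using h_t[of x t] by (simp add: ht_def names)
  have w: "w x t s' = u x t s' + al / m * cnj pp * v x t s'" for s'
    using nz by (simp add: w_def names field_simps)
  have wx: "wx x t s' = k * ux x t s' + (k * al / (lamc * m) * hh) * v x t s'" for s'
    by (simp add: wx_def y_def k_def names algebra_simps)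
  have w_eq: "w x t = (\<lambda>s. 1 * u x t s + (al / m * cnj pp) * v x t s)"
    and wx_eq: "wx x t = (\<lambda>s. k * ux x t s + (k * al / (lamc * m) * hh) * v x t s)"
    by (simp_all add: fun_eq_iff w wx)
  have cc: "cnj (al / m * cnj pp) = - (al / mc * pp)"
    by (simp add: cnj_al names)
  have herm_ww: "herm \<sigma> (w x t) (w x t) = WW"
    unfolding w_eq herm_linear cc names WW_def
    using nz by (simp add: field_simps power2_eq_square)
  have herm_wwx: "herm \<sigma> (w x t) (wx x t) = k * Wy"
    unfolding w_eq wx_eq herm_linear cc names Wy_def
    by (simp add: algebra_simps)
  have main: "((\<lambda>\<tau>. wx x \<tau> s) has_vector_derivative
      lamc / lam * ((mct * m - mc * mt) / m\<^sup>2) * ys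
      + k * ((- 1 - \<i>/2 * C) * us + (- (\<i>/2) * S) * uxs
        + ((- (al * (lamc * mt)) / (lamc * m)\<^sup>2) * vs * hh
        + al / (lamc * m) * (((- (\<i>/4) * lam\<^sup>2) * vs + (- (\<i>/2) * (A - lam * pp)) * us) * hh + vs * ht)))) (at t)"
    unfolding wx_def y_def
    apply (rule has_vector_derivative_eq_rhs)
     apply (rule mct mt ht ux_t v_t s has_vector_derivative_cdivide derivative_intros | (simp add: nz names; fail))+
    apply (simp add: names us_def[symmetric] vs_def[symmetric] uxs_def[symmetric] ys_def k_def algebra_simps)
    done
  have 1: "mct / mc - mt / m + \<i>/2 * WW = \<i>/2 * S"
    using darboux_ux_coefficient[OF nz(1,2) m_eq mc_eq al_def, of Ac A S] by (simp add: mt_def mct_def WW_def)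
  have 2: "- 1 - \<i>/2*C + al/(lamc*m)*hh*(-(\<i>/2)*(A-lam*pp)) + lam*m/(lamc*mc) + \<i>/2*Wy = 0"
    unfolding Wy_def by (rule darboux_u_coefficient[OF nz(1-3) m_eq mc_eq al_def hh_eq])
  have 3: "al/(lamc*m)*(-(\<i>/4)*lam\<^sup>2*hh + \<i>/2*S*hh + ht - hh*mt/m) + lam/(lamc*mc)*al*cnj pp + \<i>/2*(al*cnj pp/m)*Wy = 0"
    using darboux_v_coefficient[OF nz(1-3) m_eq mc_eq al_def hh_eq, of S C A] unfolding Wy_def ht_def mt_def by simp
  define yt where "yt = (- 1 - \<i>/2 * C) * us + (- (\<i>/2) * S) * uxs
        + ((- (al * (lamc * mt)) / (lamc * m)\<^sup>2) * vs * hh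
        + al / (lamc * m) * (((- (\<i>/4) * lam\<^sup>2) * vs + (- (\<i>/2) * (A - lam * pp)) * us) * hh + vs * ht))"
  \<comment> \<open>\<open>yt\<close> is the time derivative of \<open>ys\<close>. Its
    \<open>uxs\<close>-term cancels against that of \<open>\<i>/2 * S * ys\<close>; what remains are
    the coefficients of \<open>us\<close> and \<open>vs\<close>, which vanish by \<open>2\<close>
    and \<open>3\<close>.\<close>
  have 4: "yt + \<i>/2 * S * ys + lam * m / (lamc * mc) * (us + al / m * cnj pp * vs) + \<i>/2 * (us + al / m * cnj pp * vs) * Wy
    = us * (- 1 - \<i>/2*C + al/(lamc*m)*hh*(-(\<i>/2)*(A-lam*pp)) + lam*m/(lamc*mc) + \<i>/2*Wy)
    + vs * (al/(lamc*m)*(-(\<i>/4)*lam\<^sup>2*hh + \<i>/2*S*hh + ht - hh*mt/m) + lam/(lamc*mc)*al*cnj pp + \<i>/2*(al*cnj pp/m)*Wy)"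
    unfolding yt_def ys_def using nz(1-3) by (simp add: divide_simps power2_eq_square) algebra
  then have 5: "k * (yt + \<i>/2 * S * ys + lam * m / (lamc * mc) * w x t s + \<i>/2 * w x t s * Wy) = 0"
    unfolding 2 3 w by (simp add: names us_def vs_def)
  \<comment> \<open>The time derivative of the prefactor \<open>k\<close> is exactly what exchanges
    \<open>S\<close>, the form at the seed, for \<open>WW\<close>, the form at the transformed
    solution.\<close>
  have 6: "lamc / lam * ((mct * m - mc * mt) / m\<^sup>2) = k * (\<i>/2 * S - \<i>/2 * WW)"
    unfolding 1[symmetric] k_def using nz by (simp add: field_simps power2_eq_square)
  have 7: "k * (lam * m / (lamc * mc)) = 1"
    unfolding k_def using nz by (simp add: field_simps)
  have "lamc / lam * ((mct * m - mc * mt) / m\<^sup>2) * ys + k * yt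
    = - w x t s - \<i>/2 * (WW * (k * ys) + w x t s * (k * Wy))"
  proof -
    have "k * (j * S - j * W) * y + k * z = - w - j * (W * (k * y) + w * (k * Y))"
      if "k * (z + j * S * y + q * w + j * w * Y) = 0" "k * q = 1" for j q w k S W y z Y :: complex
      using that by algebra
    then show ?thesis
      using 5 7 unfolding 6 by blast
  qed
  moreover have "wx x t s = k * ys"
    by (simp add: wx ys_def uxs_def vs_def algebra_simps)
  ultimately show ?thesis
    using main unfolding herm_ww herm_wwx yt_def by simp
qed

lemma cfl_solution_on_w:
  assumes "open {(x, t). M x t \<noteq> 0}"
  shows "cfl_solution_on \<sigma> {(x, t). M x t \<noteq> 0} (\<lambda>s x t. w x t s)"
  unfolding cfl_solution_on_def
proof (intro conjI exI)
  let ?wxt = "\<lambda>s x t. - w x t s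
    - \<i>/2 * (herm \<sigma> (w x t) (w x t) * wx x t s + w x t s * herm \<sigma> (w x t) (wx x t))"
  have norm: "(of_real (cmod z))\<^sup>2 = z * cnj z" for z
    using complex_norm_square[of z] by simp
  show "\<forall>(x, t)\<in>{(x, t). M x t \<noteq> 0}.
        (\<forall>s\<in>{1, 2}.
           ((\<lambda>\<xi>. w \<xi> t s) has_vector_derivative wx x t s) (at x) \<and>
           ((\<lambda>\<tau>. wx x \<tau> s) has_vector_derivative ?wxt s x t) (at t)) \<and>
        ?wxt 1 x t + w x t 1
          + \<i> * of_real ((cmod (w x t 1))\<^sup>2 + 1/2 * \<sigma> * (cmod (w x t 2))\<^sup>2) * wx x t 1
          + \<i> / 2 * of_real \<sigma> * w x t 1 * cnj (w x t 2) * wx x t 2 = 0 \<and>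
        ?wxt 2 x t + w x t 2
          + \<i> * of_real (\<sigma> * (cmod (w x t 2))\<^sup>2 + 1/2 * (cmod (w x t 1))\<^sup>2) * wx x t 2
          + \<i> / 2 * w x t 2 * cnj (w x t 1) * wx x t 1 = 0"
  proof safe
    fix x t s assume M: "M x t \<noteq> 0"
    show "((\<lambda>\<xi>. w \<xi> t 1) has_vector_derivative wx x t 1) (at x)"
      "((\<lambda>\<xi>. w \<xi> t 2) has_vector_derivative wx x t 2) (at x)"
      using M by (auto intro: w_x)
    show "((\<lambda>\<tau>. wx x \<tau> 1) has_vector_derivative ?wxt 1 x t) (at t)"
      "((\<lambda>\<tau>. wx x \<tau> 2) has_vector_derivative ?wxt 2 x t) (at t)"
      using wx_t[OF M, of 1] wx_t[OF M, of 2] by auto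
  qed (simp_all add: herm_def norm field_simps)
qed (fact assms)

end

section \<open>Superposed exponential modes over a plane wave\<close>

definition expwave :: "complex \<Rightarrow> complex \<Rightarrow> real \<Rightarrow> real \<Rightarrow> complex" where
  "expwave \<alpha> \<beta> x t = exp (\<alpha> * of_real x + \<beta> * of_real t)"

lemma expwave_x: "((\<lambda>\<xi>. expwave \<alpha> \<beta> \<xi> t) has_vector_derivative \<alpha> * expwave \<alpha> \<beta> x t) (at x)"
  unfolding expwave_def
  by (rule has_vector_derivative_real_field) (auto intro!: derivative_eq_intros)

lemma expwave_t: "((\<lambda>\<tau>. expwave \<alpha> \<beta> x \<tau>) has_vector_derivative \<beta> * expwave \<alpha> \<beta> x t) (at t)"
  unfolding expwave_def
  by (rule has_vector_derivative_real_field) (auto intro!: derivative_eq_intros)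

abbreviation carrier_wave :: "(nat \<Rightarrow> real) \<Rightarrow> (nat \<Rightarrow> real) \<Rightarrow> real \<Rightarrow> real \<Rightarrow> nat \<Rightarrow> complex" where
  "carrier_wave b \<Omega> x t s \<equiv> expwave (\<i> * b s) (\<i> * \<Omega> s) x t"

text \<open>As \<open>b\<close> and \<open>\<Omega>\<close> are real, each carrier wave has modulus
  one, so its phase drops out componentwise.\<close>

lemma herm_carrier_wave:
  "herm \<sigma> (\<lambda>s. f s * carrier_wave b \<Omega> x t s) (\<lambda>s. g s * carrier_wave b \<Omega> x t s) = herm \<sigma> f g"
proof -
  have "cnj (f s * carrier_wave b \<Omega> x t s) * (g s * carrier_wave b \<Omega> x t s) = cnj (f s) * g s" for s
  proof -
    have "cnj (carrier_wave b \<Omega> x t s) * carrier_wave b \<Omega> x t s = 1"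
      by (simp add: expwave_def exp_cnj flip: exp_add)
    then show ?thesis by (metis mult.assoc mult.commute mult.right_neutral complex_cnj_mult)
  qed
  then show ?thesis by (simp only: herm_def mult.assoc)
qed

lemma herm_sum_right:
  "herm \<sigma> f (\<lambda>s. \<Sum>m\<in>I. c m * d m s * E m) = (\<Sum>m\<in>I. c m * herm \<sigma> f (d m) * E m)"
  by (simp add: herm_def sum_distrib_left sum.distrib[symmetric] algebra_simps)

text \<open>
  The Lax pair over a plane wave, for the ansatz \<open>p = e E\<close> and \<open>v s = d s E\<close> times the carrier wave
  of \<open>u s\<close>, with \<open>E = exp (\<i> (\<kappa> - \<lambda>\<^sup>-\<^sup>2) x + \<i> \<eta> t)\<close>.
\<close>

definition lax_mode ::
    "real \<Rightarrow> complex \<Rightarrow> (nat \<Rightarrow> real) \<Rightarrow> (nat \<Rightarrow> real) \<Rightarrow> (nat \<Rightarrow> real)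
      \<Rightarrow> complex \<Rightarrow> complex \<Rightarrow> complex \<Rightarrow> (nat \<Rightarrow> complex) \<Rightarrow> bool" where
  "lax_mode \<sigma> lam a b \<Omega> \<kappa> \<eta> e d \<longleftrightarrow>
     (\<kappa> - 2 / lam\<^sup>2) * e = - herm \<sigma> (\<lambda>s. a s * b s) d / lam \<and>
     \<eta> * e = lam\<^sup>2 / 4 * e + 1/2 * (((a 1)\<^sup>2 + \<sigma> * (a 2)\<^sup>2) * e - lam * herm \<sigma> (\<lambda>s. a s) d) \<and>
     (\<forall>s\<in>{1, 2}. (\<kappa> + b s) * d s = b s * a s * e / lam \<and>
       (\<Omega> s + \<eta>) * d s = - (lam\<^sup>2 / 4) * d s - 1/2 * (a s * herm \<sigma> (\<lambda>s. a s) d - lam * a s * e))"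

text \<open>The assumption \<open>dispersion\<close> makes the plane wave with amplitudes
  \<open>a\<close> a solution of the system; \<open>c\<close> holds the weights of the superposed
  modes.\<close>

locale plane_wave_modes =
  fixes \<sigma> :: real and lam :: complex and a b \<Omega> :: "nat \<Rightarrow> real" and \<kappa> \<eta> e c :: "nat \<Rightarrow> complex"
    and d :: "nat \<Rightarrow> nat \<Rightarrow> complex" and I :: "nat set"
  assumes lam: "lam \<noteq> 0"
    and dispersion: "s \<in> {1, 2} \<Longrightarrow> \<Omega> s * b s
      = 1 - (((a 1)\<^sup>2 + \<sigma> * (a 2)\<^sup>2) * b s + ((a 1)\<^sup>2 * b 1 + \<sigma> * (a 2)\<^sup>2 * b 2)) / 2"
    and mode: "m \<in> I \<Longrightarrow> lax_mode \<sigma> lam a b \<Omega> (\<kappa> m) (\<eta> m) (e m) (d m)"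
begin

lemmas mode_p_x = mode[unfolded lax_mode_def, THEN conjunct1]
  and mode_p_t = mode[unfolded lax_mode_def, THEN conjunct2, THEN conjunct1]
  and mode_v_x = mode[unfolded lax_mode_def, THEN conjunct2, THEN conjunct2, THEN bspec, THEN conjunct1]
  and mode_v_t = mode[unfolded lax_mode_def, THEN conjunct2, THEN conjunct2, THEN bspec, THEN conjunct2]

definition E :: "real \<Rightarrow> real \<Rightarrow> nat \<Rightarrow> complex" where
  "E x t m = expwave (\<i> * (\<kappa> m - 1 / lam\<^sup>2)) (\<i> * \<eta> m) x t"

definition "u x t s = a s * carrier_wave b \<Omega> x t s"
definition "ux x t s = \<i> * b s * a s * carrier_wave b \<Omega> x t s"
definition "p x t = (\<Sum>m\<in>I. c m * e m * E x t m)"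
definition "v x t s = (\<Sum>m\<in>I. c m * d m s * E x t m) * carrier_wave b \<Omega> x t s"

lemma E_x: "((\<lambda>\<xi>. E \<xi> t m) has_vector_derivative \<i> * (\<kappa> m - 1 / lam\<^sup>2) * E x t m) (at x)"
  unfolding E_def by (rule expwave_x)

lemma E_t: "((\<lambda>\<tau>. E x \<tau> m) has_vector_derivative \<i> * \<eta> m * E x t m) (at t)"
  unfolding E_def by (rule expwave_t)

lemma herm_u_u: "herm \<sigma> (u x t) (u x t) = (a 1)\<^sup>2 + \<sigma> * (a 2)\<^sup>2"
  unfolding u_def herm_carrier_wave by (simp add: herm_def power2_eq_square)

lemma herm_u_ux: "herm \<sigma> (u x t) (ux x t) = \<i> * ((a 1)\<^sup>2 * b 1 + \<sigma> * (a 2)\<^sup>2 * b 2)"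
  unfolding u_def ux_def herm_carrier_wave by (simp add: herm_def power2_eq_square algebra_simps)

lemma herm_u_v: "herm \<sigma> (u x t) (v x t) = (\<Sum>m\<in>I. c m * herm \<sigma> (\<lambda>s. a s) (d m) * E x t m)"
  unfolding u_def v_def herm_carrier_wave by (rule herm_sum_right[where E = "E x t" and d = d and c = c])

lemma herm_ux_v: "herm \<sigma> (ux x t) (v x t) = - \<i> * (\<Sum>m\<in>I. c m * herm \<sigma> (\<lambda>s. a s * b s) (d m) * E x t m)"
proof -
  have "herm \<sigma> (ux x t) (v x t) = (\<Sum>m\<in>I. c m * herm \<sigma> (\<lambda>s. \<i> * b s * a s) (d m) * E x t m)"
    unfolding ux_def v_def herm_carrier_wave by (rule herm_sum_right[where E = "E x t" and d = d and c = c])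
  moreover have "herm \<sigma> (\<lambda>s. \<i> * b s * a s) (d m) = - \<i> * herm \<sigma> (\<lambda>s. a s * b s) (d m)" for m
    by (simp add: herm_def algebra_simps)
  ultimately show ?thesis by (simp add: sum_distrib_left algebra_simps)
qed

text \<open>The Lax pair is linear in \<open>(p, v)\<close>, so each of its equations is checked
  summand by summand with the matching clause of \<open>lax_mode\<close>; \<open>dispersion\<close>
  takes care of the background.\<close>

sublocale lax_eigenfunction \<sigma> lam u ux v p
proof
  fix x t :: real and s :: nat
  show "lam \<noteq> 0" by (rule lam)
  show "((\<lambda>\<xi>. u \<xi> t s) has_vector_derivative ux x t s) (at x)"
    unfolding u_def ux_def
    by (rule has_vector_derivative_eq_rhs, (rule derivative_intros expwave_x)+) simp
  show "((\<lambda>\<tau>. ux x \<tau> s) has_vector_derivative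
        (- 1 - \<i>/2 * herm \<sigma> (u x t) (ux x t)) * u x t s
        + (- (\<i>/2) * herm \<sigma> (u x t) (u x t)) * ux x t s) (at t)" if s: "s \<in> {1, 2}"
  proof -
    have *: "\<i> * B * A * (\<i> * F * W) = (- 1 - \<i>/2 * (\<i> * T)) * (A * W) + (- (\<i>/2) * S) * (\<i> * B * A * W)"
      if "F * B = 1 - (S * B + T) / 2" for A B F W S T :: complex
    proof -
      have T: "T = 2 - 2 * F * B - S * B" using that by (simp add: field_simps)
      show ?thesis unfolding T by (simp add: field_simps)
    qed
    have "complex_of_real (\<Omega> s) * complex_of_real (b s) = 1 - (complex_of_real ((a 1)\<^sup>2 + \<sigma> * (a 2)\<^sup>2) * complex_of_real (b s)
        + complex_of_real ((a 1)\<^sup>2 * b 1 + \<sigma> * (a 2)\<^sup>2 * b 2)) / 2"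
      using arg_cong[OF dispersion[OF s], of complex_of_real] by simp
    note * [OF this, of "of_real (a s)" "carrier_wave b \<Omega> x t s"]
    then show ?thesis
      unfolding herm_u_ux herm_u_u unfolding u_def ux_def
      by - (rule has_vector_derivative_eq_rhs, (rule derivative_intros expwave_t)+, simp)
  qed
  show "((\<lambda>\<xi>. p \<xi> t) has_vector_derivative
        \<i> / lam\<^sup>2 * p x t + herm \<sigma> (ux x t) (v x t) / lam) (at x)"
    unfolding herm_ux_v unfolding p_def
    apply (rule has_vector_derivative_eq_rhs, (rule derivative_intros E_x)+)
    apply (simp only: sum_distrib_left sum_divide_distrib sum.distrib[symmetric])
    apply (rule sum.cong[OF refl])
    subgoal for m using mode_p_x[of m] lam by (simp add: divide_simps) algebra
    done
  show "((\<lambda>\<tau>. p x \<tau>) has_vector_derivative \<i>/4 * lam\<^sup>2 * p x t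
      + \<i>/2 * (herm \<sigma> (u x t) (u x t) * p x t - lam * herm \<sigma> (u x t) (v x t))) (at t)"
    unfolding herm_u_v herm_u_u unfolding p_def
    apply (rule has_vector_derivative_eq_rhs, (rule derivative_intros E_t)+)
    apply (simp only: sum_distrib_left sum_subtractf[symmetric] sum.distrib[symmetric])
    apply (rule sum.cong[OF refl])
    subgoal for m using mode_p_t[of m] lam by (simp add: divide_simps) algebra
    done
  show "((\<lambda>\<xi>. v \<xi> t s) has_vector_derivative
        - (\<i> / lam\<^sup>2) * v x t s + p x t / lam * ux x t s) (at x)" if "s \<in> {1, 2}"
    unfolding v_def ux_def p_def
    apply (rule has_vector_derivative_eq_rhs, (rule derivative_intros E_x expwave_x)+)
    apply (simp only: sum_distrib_left sum_distrib_right sum_divide_distrib sum.distrib[symmetric])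
    apply (rule sum.cong[OF refl])
    subgoal for m using mode_v_x[OF _ that, of m] lam by (simp add: divide_simps) algebra
    done
  show "((\<lambda>\<tau>. v x \<tau> s) has_vector_derivative (- (\<i>/4) * lam\<^sup>2) * v x t s
      + (- (\<i>/2) * (herm \<sigma> (u x t) (v x t) - lam * p x t)) * u x t s) (at t)" if "s \<in> {1, 2}"
    unfolding herm_u_v unfolding v_def p_def u_def
    apply (rule has_vector_derivative_eq_rhs, (rule derivative_intros E_t expwave_t)+)
    apply (simp only: sum_distrib_left sum_distrib_right sum_divide_distrib sum_subtractf[symmetric] sum.distrib[symmetric])
    apply (rule sum.cong[OF refl])
    subgoal for m using mode_v_t[OF _ that, of m] lam by (simp add: divide_simps) algebra
    done
qed

lemma herm_v_v: "herm \<sigma> (v x t) (v x t) = (\<Sum>l\<in>I. \<Sum>m\<in>I. herm \<sigma> (d l) (d m) * cnj (c l) * c m * (cnj (E x t l) * E x t m))"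
proof -
  let ?f = "\<lambda>s. \<Sum>m\<in>I. c m * d m s * E x t m"
  have "herm \<sigma> (v x t) (v x t) = herm \<sigma> ?f ?f"
    unfolding v_def by (rule herm_carrier_wave)
  also have "\<dots> = (\<Sum>m\<in>I. c m * cnj (herm \<sigma> (d m) ?f) * E x t m)"
    by (subst herm_sum_right) (simp add: cnj_herm)
  also have "\<dots> = (\<Sum>m\<in>I. \<Sum>l\<in>I. herm \<sigma> (d l) (d m) * cnj (c l) * c m * (cnj (E x t l) * E x t m))"
    unfolding herm_sum_right cnj_sum
    by (simp add: cnj_herm sum_distrib_left sum_distrib_right mult_ac)
  also have "\<dots> = (\<Sum>l\<in>I. \<Sum>m\<in>I. herm \<sigma> (d l) (d m) * cnj (c l) * c m * (cnj (E x t l) * E x t m))"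
    by (rule sum.swap)
  finally show ?thesis .
qed

lemma M_eq: "M x t = (\<Sum>l\<in>I. \<Sum>m\<in>I. (lam * (cnj (e l) * e m) - lamc * herm \<sigma> (d l) (d m))
    * cnj (c l) * c m * (cnj (E x t l) * E x t m))"
proof -
  have "p x t * cnj (p x t) = (\<Sum>l\<in>I. \<Sum>m\<in>I. cnj (e l) * e m * cnj (c l) * c m * (cnj (E x t l) * E x t m))"
    unfolding mult.commute[of "p x t"] unfolding p_def cnj_sum sum_product by (simp add: mult_ac)
  then show ?thesis
    unfolding M_def herm_v_v
    by (simp add: sum_distrib_left sum_subtractf[symmetric] algebra_simps)
qed

lemma w_numerator_eq: "u x t s * M x t + al * v x t s * cnj (p x t) = (\<Sum>l\<in>I. \<Sum>m\<in>I.
    (a s * (lam * (cnj (e l) * e m) - lamc * herm \<sigma> (d l) (d m)) + al * d m s * cnj (e l))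
    * cnj (c l) * c m * (cnj (E x t l) * E x t m)) * carrier_wave b \<Omega> x t s"
proof -
  have "cnj (p x t) * v x t s = (\<Sum>l\<in>I. \<Sum>m\<in>I. d m s * cnj (e l) * cnj (c l) * c m * (cnj (E x t l) * E x t m)) * carrier_wave b \<Omega> x t s"
    unfolding v_def mult.assoc[symmetric] unfolding p_def cnj_sum sum_product by (simp add: mult_ac)
  then have "al * v x t s * cnj (p x t) = (\<Sum>l\<in>I. \<Sum>m\<in>I. al * (d m s * cnj (e l) * cnj (c l) * c m * (cnj (E x t l) * E x t m))) * carrier_wave b \<Omega> x t s"
    unfolding sum_distrib_left[symmetric] by (simp only: mult_ac)
  moreover have "u x t s * M x t = (\<Sum>l\<in>I. \<Sum>m\<in>I. a s * ((lam * (cnj (e l) * e m) - lamc * herm \<sigma> (d l) (d m))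
    * cnj (c l) * c m * (cnj (E x t l) * E x t m))) * carrier_wave b \<Omega> x t s"
    unfolding M_eq u_def sum_distrib_left[symmetric] by (simp only: mult_ac)
  ultimately show ?thesis
    apply (simp only: distrib_right[symmetric] sum.distrib[symmetric])
    apply (rule arg_cong2[where f = times, OF _ refl])
    apply (intro sum.cong refl)
    by (simp add: algebra_simps)
qed

end

section \<open>Frequencies and explicit modes\<close>

text \<open>The dispersion relation solved for the time frequency, uniformly in both
  components.\<close>

definition frequency :: "real \<Rightarrow> (nat \<Rightarrow> real) \<Rightarrow> (nat \<Rightarrow> real) \<Rightarrow> nat \<Rightarrow> real" where
  "frequency \<sigma> a b s = 1 / b s - ((a 1)\<^sup>2 + \<sigma> * (a 2)\<^sup>2 + ((a 1)\<^sup>2 * b 1 + \<sigma> * (a 2)\<^sup>2 * b 2) / b s) / 2"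

lemma omega_eq:
  assumes "b 1 \<noteq> 0" "b 2 \<noteq> 0" "s \<in> {1, 2}"
  shows "omega \<sigma> a b s x t = b s * x + frequency \<sigma> a b s * t"
  using assms by (auto simp: omega_def frequency_def field_simps)

text \<open>The quadratic or cubic equation divided by the factors \<open>\<kappa> + b s\<close>.
  This form serves equal and distinct \<open>b\<close> alike and keeps \<open>\<kappa>\<close> away
  from the poles of \<open>regular_mode\<close>.\<close>

definition char_root :: "real \<Rightarrow> (nat \<Rightarrow> real) \<Rightarrow> (nat \<Rightarrow> real) \<Rightarrow> complex \<Rightarrow> complex \<Rightarrow> bool" where
  "char_root \<sigma> a b z \<kappa> \<longleftrightarrow> \<kappa> + b 1 \<noteq> 0 \<and> \<kappa> + b 2 \<noteq> 0 \<and>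
     \<kappa> / z - 2 + (a 1)\<^sup>2 * (b 1)\<^sup>2 / (\<kappa> + b 1) + \<sigma> * (a 2)\<^sup>2 * (b 2)\<^sup>2 / (\<kappa> + b 2) = 0"

text \<open>
  The exact time frequencies exceed those in \<open>vartheta\<close> by this constant. As it does not depend on
  \<open>\<kappa>\<close>, it contributes a common factor to \<open>(p, v)\<close>, which cancels in the Darboux quotient.
\<close>

definition gauge :: "real \<Rightarrow> (nat \<Rightarrow> real) \<Rightarrow> (nat \<Rightarrow> real) \<Rightarrow> complex \<Rightarrow> complex" where
  "gauge \<sigma> a b z = 1 / (4 * z) + (((a 1)\<^sup>2 * b 1 + \<sigma> * (a 2)\<^sup>2 * b 2 - 1) * (b 1 + b 2) - z) / (2 * b 1 * b 2)"

definition mode_freq :: "real \<Rightarrow> (nat \<Rightarrow> real) \<Rightarrow> (nat \<Rightarrow> real) \<Rightarrow> complex \<Rightarrow> complex \<Rightarrow> complex" where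
  "mode_freq \<sigma> a b z \<kappa> = (\<kappa> - z) * (\<kappa> - z + b 1 + b 2) / (2 * b 1 * b 2 * z) + gauge \<sigma> a b z"

definition regular_mode :: "complex \<Rightarrow> (nat \<Rightarrow> real) \<Rightarrow> (nat \<Rightarrow> real) \<Rightarrow> complex \<Rightarrow> nat \<Rightarrow> complex" where
  "regular_mode lam a b \<kappa> s = a s * b s / (lam * (\<kappa> + b s))"

text \<open>The right-hand side is the frequency prescribed by the time equation for
  \<open>p\<close>. The characteristic equation trades its fractions for the expression quadratic in
  \<open>\<kappa>\<close> that occurs in \<open>vartheta\<close>, up to the gauge constant.\<close>

lemma regular_mode_p_t:
  fixes a1 a2 b1 b2 \<sigma> \<kappa> z :: complex
  assumes "\<kappa> + b1 \<noteq> 0" "\<kappa> + b2 \<noteq> 0" "b1 \<noteq> 0" "b2 \<noteq> 0" "z \<noteq> 0"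
    and root: "\<kappa> / z - 2 + a1\<^sup>2 * b1\<^sup>2 / (\<kappa> + b1) + \<sigma> * a2\<^sup>2 * b2\<^sup>2 / (\<kappa> + b2) = 0"
  shows "(\<kappa> - z) * (\<kappa> - z + b1 + b2) / (2 * b1 * b2 * z) + (1 / (4 * z) + ((a1\<^sup>2 * b1 + \<sigma> * a2\<^sup>2 * b2 - 1) * (b1 + b2) - z) / (2 * b1 * b2))
    = 1 / (4 * z) + 1/2 * (a1\<^sup>2 + \<sigma> * a2\<^sup>2 - (a1\<^sup>2 * b1 / (\<kappa> + b1) + \<sigma> * a2\<^sup>2 * b2 / (\<kappa> + b2)))"
proof -
  \<comment> \<open>Once the reciprocals are unknowns of their own, the core of the claim is an
    ideal membership with generators \<open>r\<close> and \<open>root'\<close>.\<close>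
  define r1 r2 where "r1 = 1 / (\<kappa> + b1)" and "r2 = 1 / (\<kappa> + b2)"
  define q where "q = \<kappa> / z"
  have r: "r1 * (\<kappa> + b1) = 1" "r2 * (\<kappa> + b2) = 1" using assms by (simp_all add: r1_def r2_def)
  have root': "q - 2 + a1\<^sup>2 * b1\<^sup>2 * r1 + \<sigma> * a2\<^sup>2 * b2\<^sup>2 * r2 = 0"
    using root by (simp add: r1_def r2_def q_def)
  have "(\<kappa> - z) * (\<kappa> - z + b1 + b2) / z + ((a1\<^sup>2 * b1 + \<sigma> * a2\<^sup>2 * b2 - 1) * (b1 + b2) - z)
    = (b1 + b2) * (a1\<^sup>2 * b1 + \<sigma> * a2\<^sup>2 * b2 - 2 + q) + \<kappa> * (q - 2)"
    using assms(5) by (simp add: q_def field_simps power2_eq_square)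
  also have "\<dots> = b1 * b2 * (a1\<^sup>2 + \<sigma> * a2\<^sup>2 - (a1\<^sup>2 * b1 * r1 + \<sigma> * a2\<^sup>2 * b2 * r2))"
    using root' r by algebra
  finally have *: "(\<kappa> - z) * (\<kappa> - z + b1 + b2) / z + ((a1\<^sup>2 * b1 + \<sigma> * a2\<^sup>2 * b2 - 1) * (b1 + b2) - z) = \<dots>" .
  have "(\<kappa> - z) * (\<kappa> - z + b1 + b2) / (2 * b1 * b2 * z) + (1 / (4 * z) + ((a1\<^sup>2 * b1 + \<sigma> * a2\<^sup>2 * b2 - 1) * (b1 + b2) - z) / (2 * b1 * b2))
    = 1 / (4 * z) + ((\<kappa> - z) * (\<kappa> - z + b1 + b2) / z + ((a1\<^sup>2 * b1 + \<sigma> * a2\<^sup>2 * b2 - 1) * (b1 + b2) - z)) / (2 * (b1 * b2))"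
    by (simp add: add_divide_distrib mult_ac)
  then show ?thesis
    unfolding * using assms(3,4) by (simp add: r1_def r2_def)
qed

text \<open>\<open>F\<close> is the dispersion relation, \<open>\<eta>\<close> the frequency
  prescribed by the equation for \<open>p\<close>, and \<open>D\<close> a form of the characteristic
  equation; together they annihilate the one bracket left after a common factor is split
  off.\<close>

lemma regular_mode_v_t:
  fixes F \<eta> a b \<kappa> lam S T D z :: complex
  assumes "lam \<noteq> 0" "b \<noteq> 0" "\<kappa> + b \<noteq> 0" and F: "F * b = 1 - (S * b + T) / 2"
    and \<eta>: "\<eta> = lam\<^sup>2 / 4 + 1/2 * (S - lam * D)" and D: "\<kappa> * (lam * D) = T - 2 + \<kappa> * lam\<^sup>2"
  shows "(F + \<eta>) * (a * b / (lam * (\<kappa> + b))) = - (lam\<^sup>2 / 4) * (a * b / (lam * (\<kappa> + b))) - 1/2 * (a * D - lam * a)"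
proof -
  have *: "(F + lam\<^sup>2 / 2 + 1/2 * (S - lam * D)) * b + 1/2 * (\<kappa> + b) * (lam * D - lam\<^sup>2) = 0"
  proof -
    have "T = 2 - 2 * F * b - S * b" using F by (simp add: field_simps)
    with D have *: "\<kappa> * (lam * D) = \<kappa> * lam\<^sup>2 - 2 * F * b - S * b" by simp
    have "(F + lam\<^sup>2 / 2 + 1/2 * (S - lam * D)) * b + 1/2 * (\<kappa> + b) * (lam * D - lam\<^sup>2)
      = F * b + S * b / 2 + (\<kappa> * (lam * D) - \<kappa> * lam\<^sup>2) / 2"
      by (simp add: field_simps)
    then show ?thesis unfolding * by (simp add: field_simps)
  qed
  have "(F + \<eta>) * (a * b / (lam * (\<kappa> + b))) + (lam\<^sup>2 / 4) * (a * b / (lam * (\<kappa> + b))) + 1/2 * (a * D - lam * a)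
    = a / (lam * (\<kappa> + b)) * ((F + lam\<^sup>2 / 2 + 1/2 * (S - lam * D)) * b + 1/2 * (\<kappa> + b) * (lam * D - lam\<^sup>2))"
    unfolding \<eta> using assms(1,3) by (simp add: divide_simps power2_eq_square) algebra
  then show ?thesis unfolding * by (simp add: algebra_simps eq_neg_iff_add_eq_0 add_eq_0_iff)
qed

lemma frequency_dispersion:
  assumes "b s \<noteq> 0"
  shows "frequency \<sigma> a b s * b s
      = 1 - (((a 1)\<^sup>2 + \<sigma> * (a 2)\<^sup>2) * b s + ((a 1)\<^sup>2 * b 1 + \<sigma> * (a 2)\<^sup>2 * b 2)) / 2"
  using assms by (simp add: frequency_def field_simps)

lemma lax_mode_regular:
  assumes "lam \<noteq> 0" "b 1 \<noteq> 0" "b 2 \<noteq> 0" and root: "char_root \<sigma> a b (1 / lam\<^sup>2) \<kappa>"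
  shows "lax_mode \<sigma> lam a b (frequency \<sigma> a b) \<kappa> (mode_freq \<sigma> a b (1 / lam\<^sup>2) \<kappa>) 1 (regular_mode lam a b \<kappa>)"
proof -
  let ?d = "regular_mode lam a b \<kappa>"
  let ?T = "complex_of_real ((a 1)\<^sup>2 * b 1 + \<sigma> * (a 2)\<^sup>2 * b 2)"
  have k: "\<kappa> + b 1 \<noteq> 0" "\<kappa> + b 2 \<noteq> 0" and
    r: "\<kappa> * lam\<^sup>2 - 2 + (a 1)\<^sup>2 * (b 1)\<^sup>2 / (\<kappa> + b 1) + \<sigma> * (a 2)\<^sup>2 * (b 2)\<^sup>2 / (\<kappa> + b 2) = 0"
    using root by (auto simp: char_root_def)
  have D1: "herm \<sigma> (\<lambda>s. a s * b s) ?d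
      = ((a 1)\<^sup>2 * (b 1)\<^sup>2 / (\<kappa> + b 1) + \<sigma> * (a 2)\<^sup>2 * (b 2)\<^sup>2 / (\<kappa> + b 2)) / lam"
    using assms(1) k by (simp add: herm_def regular_mode_def power2_eq_square add_divide_distrib mult_ac)
  have D0': "herm \<sigma> (\<lambda>s. a s) ?d
      = ((a 1)\<^sup>2 * b 1 / (\<kappa> + b 1) + \<sigma> * (a 2)\<^sup>2 * b 2 / (\<kappa> + b 2)) / lam"
    using assms(1) k by (simp add: herm_def regular_mode_def power2_eq_square add_divide_distrib mult_ac)
  have D0: "lam * herm \<sigma> (\<lambda>s. a s) ?d
      = (a 1)\<^sup>2 * b 1 / (\<kappa> + b 1) + \<sigma> * (a 2)\<^sup>2 * b 2 / (\<kappa> + b 2)"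
    unfolding D0' using assms(1) by simp
  have E1: "lam * herm \<sigma> (\<lambda>s. a s * b s) ?d = 2 - \<kappa> * lam\<^sup>2"
  proof -
    have "lam * herm \<sigma> (\<lambda>s. a s * b s) ?d
        = (a 1)\<^sup>2 * (b 1)\<^sup>2 / (\<kappa> + b 1) + \<sigma> * (a 2)\<^sup>2 * (b 2)\<^sup>2 / (\<kappa> + b 2)"
      unfolding D1 using assms(1) by simp
    with r show ?thesis by (simp add: algebra_simps)
  qed
  \<comment> \<open>This links the sum with numerators \<open>a^2 b\<close> to the one with
    \<open>a^2 b^2\<close>, which the characteristic equation evaluates.\<close>
  have "\<kappa> * (a * a * b / (\<kappa> + b)) + a\<^sup>2 * b\<^sup>2 / (\<kappa> + b) = a\<^sup>2 * b" if "\<kappa> + b \<noteq> 0" for a b :: complex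
    using that by (simp add: divide_simps power2_eq_square) algebra
  note this[OF k(1), of "a 1"] this[OF k(2), of "a 2"]
  then have E0: "\<kappa> * (lam * herm \<sigma> (\<lambda>s. a s) ?d) = ?T - 2 + \<kappa> * lam\<^sup>2"
    using r unfolding D0 apply (simp add: power2_eq_square) by algebra
  have freq: "mode_freq \<sigma> a b (1 / lam\<^sup>2) \<kappa> = lam\<^sup>2 / 4
      + 1/2 * (complex_of_real ((a 1)\<^sup>2 + \<sigma> * (a 2)\<^sup>2) - lam * herm \<sigma> (\<lambda>s. a s) ?d)"
    unfolding D0 mode_freq_def gauge_def
    using regular_mode_p_t[OF k _ _ _ root[unfolded char_root_def, THEN conjunct2, THEN conjunct2, simplified of_real_mult of_real_power]] assms(1-3)
    by simp
  have vt: "(frequency \<sigma> a b s + mode_freq \<sigma> a b (1 / lam\<^sup>2) \<kappa>) * ?d s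
      = - (lam\<^sup>2 / 4) * ?d s - 1/2 * (a s * herm \<sigma> (\<lambda>s. a s) ?d - lam * a s)" if s: "s \<in> {1, 2}" for s
    unfolding regular_mode_def[of lam a b \<kappa> s]
    apply (rule regular_mode_v_t[OF assms(1) _ _ _ freq E0])
    using s k assms(2,3) arg_cong[OF frequency_dispersion[of b s \<sigma> a], of complex_of_real] by auto
  have px: "(\<kappa> - 2 / lam\<^sup>2) * 1 = - herm \<sigma> (\<lambda>s. a s * b s) ?d / lam"
  proof -
    have H: "herm \<sigma> (\<lambda>s. a s * b s) ?d = (2 - \<kappa> * lam\<^sup>2) / lam"
      using E1 assms(1) by (simp add: eq_divide_eq mult.commute)
    show ?thesis unfolding H using assms(1) by (simp add: field_simps power2_eq_square)
  qed
  have vx: "(\<kappa> + b s) * ?d s = b s * a s * 1 / lam" if "s \<in> {1, 2}" for s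
    using that k by (auto simp: regular_mode_def)
  show ?thesis
    unfolding lax_mode_def using px vx vt freq by auto
qed

text \<open>
  For \<open>b 1 = b 2\<close> the root \<open>- b 1\<close> of the cubic carries the solution with \<open>p = 0\<close> and \<open>v\<close>
  orthogonal to the background.
\<close>

definition degenerate_mode :: "real \<Rightarrow> (nat \<Rightarrow> real) \<Rightarrow> nat \<Rightarrow> complex" where
  "degenerate_mode \<sigma> a s = (if s = 1 then - of_real (\<sigma> * a 2 / a 1) else 1)"

lemma lax_mode_degenerate:
  assumes "lam \<noteq> 0" "b 1 \<noteq> 0" "b 1 = b 2" "a 1 \<noteq> 0"
  shows "lax_mode \<sigma> lam a b (frequency \<sigma> a b) (- b 1) (mode_freq \<sigma> a b (1 / lam\<^sup>2) (- b 1)) 0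
    (degenerate_mode \<sigma> a)"
proof -
  let ?d = "degenerate_mode \<sigma> a"
  have "herm \<sigma> (\<lambda>s. a s) ?d = 0"
    using assms(4) by (simp add: herm_def degenerate_mode_def)
  moreover have "herm \<sigma> (\<lambda>s. a s * b s) ?d = 0"
    using assms(3,4) by (simp add: herm_def degenerate_mode_def)
  \<comment> \<open>With \<open>p = 0\<close> and both forms zero, only this phase balance is left
    of the time equation for \<open>v\<close>; for equal \<open>b\<close> it is the same for both
    components.\<close>
  moreover have "frequency \<sigma> a b s + mode_freq \<sigma> a b (1 / lam\<^sup>2) (- b 1) = - (lam\<^sup>2 / 4)" if "s \<in> {1, 2}" for s
    using that assms(1-3) by (auto simp: frequency_def mode_freq_def gauge_def field_simps power2_eq_square)
  ultimately show ?thesis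
    unfolding lax_mode_def using assms(3) by (simp del: One_nat_def)
qed

section \<open>Matching the Darboux quotient with the stated formula\<close>

lemma expwave_vartheta:
  assumes "z \<noteq> 0"
  shows "expwave (\<i> * (\<kappa> m - z)) (\<i> * mode_freq \<sigma> a b z (\<kappa> m)) x t
    = exp (\<i> * gauge \<sigma> a b z * t) * exp (vartheta b z \<kappa> m x t)"
proof -
  have "cnj z / of_real (2 * b 1 * b 2 * (cmod z)\<^sup>2) = 1 / (2 * b 1 * b 2 * z)"
    using assms unfolding of_real_mult complex_norm_square by (simp add: mult_ac)
  then show ?thesis
    unfolding expwave_def vartheta_def mode_freq_def exp_add[symmetric]
    by (simp add: algebra_simps add_divide_distrib diff_divide_distrib)
qed

text \<open>The product \<open>a s * K_coeff\<close>, read as in \<open>a_times_N3\<close> when \<open>a 2 = 0\<close>.\<close>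

definition aK_coeff ::
    "param_class \<Rightarrow> real \<Rightarrow> (nat \<Rightarrow> real) \<Rightarrow> (nat \<Rightarrow> real) \<Rightarrow> complex \<Rightarrow> (nat \<Rightarrow> complex)
      \<Rightarrow> nat \<Rightarrow> nat \<Rightarrow> nat \<Rightarrow> complex" where
  "aK_coeff \<Omega> \<sigma> a b lam \<kappa> s l m =
    (if s = 2 \<and> a 2 = 0 then (if l \<in> {1, 2} \<and> m = 3 then lam else 0)
     else of_real (a s) * K_coeff \<Omega> \<sigma> a b lam \<kappa> s l m)"

lemma a_times_N3_eq:
  "a_times_N3 \<Omega> \<sigma> a b lam \<kappa> c s x t = (\<Sum>l\<in>{1..3}. \<Sum>m\<in>{1..3}. aK_coeff \<Omega> \<sigma> a b lam \<kappa> s l m * cnj (c l) * c m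
     * exp (cnj (vartheta b (z1 lam) \<kappa> l x t) + vartheta b (z1 lam) \<kappa> m x t))"
proof -
  have I: "{1..3::nat} = {1, 2, 3}" by auto
  show ?thesis
  proof (cases "s = 2 \<and> a 2 = 0")
    case True
    then show ?thesis
      by (simp add: a_times_N3_def aK_coeff_def I mult_ac add_ac del: One_nat_def)
  next
    case False
    then show ?thesis
      by (auto simp: a_times_N3_def aK_coeff_def N3_def sum_distrib_left mult_ac add_ac)
  qed
qed

lemma open_M1_nonzero: "open {(x, t). M1 \<Omega> \<sigma> a b lam \<kappa> c x t \<noteq> 0}"
  unfolding M1_def vartheta_def case_prod_beta
  by (intro open_Collect_neq continuous_intros)

lemma cfl_solution_on_cong:
  assumes "\<And>s x t. s \<in> {1, 2} \<Longrightarrow> f s x t = g s x t"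
  shows "cfl_solution_on \<sigma> U f \<longleftrightarrow> cfl_solution_on \<sigma> U g"
proof -
  have "f 1 = g 1" "f 2 = g 2"
    using assms by (auto simp: fun_eq_iff)
  then show ?thesis by (simp add: cfl_solution_on_def)
qed

text \<open>Reduces each parameter class to a choice of modes \<open>(e, d)\<close>.
  \<open>Z\<close> and \<open>K\<close> say that the pair coefficients of \<open>M\<close> and of
  the numerator of \<open>w\<close> are the stated ones times \<open>al / lam\<close>, a factor that
  cancels in the quotient.\<close>

theorem cfl_solution_on_u1fold:
  assumes "lam \<noteq> 0" "cnj lam ^ 2 \<noteq> lam ^ 2" "b 1 \<noteq> 0" "b 2 \<noteq> 0"
    and mode: "\<And>m. m \<in> {1..3} \<Longrightarrow> lax_mode \<sigma> lam a b (frequency \<sigma> a b) (\<kappa> m)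
        (mode_freq \<sigma> a b (1 / lam\<^sup>2) (\<kappa> m)) (e m) (d m)"
    and Z: "\<And>l m. l \<in> {1..3} \<Longrightarrow> m \<in> {1..3} \<Longrightarrow>
        lam * (cnj (e l) * e m) - cnj lam * herm \<sigma> (d l) (d m)
          = ((cnj lam)\<^sup>2 - lam\<^sup>2) / lam * Z_coeff \<Omega> \<sigma> a lam \<kappa> l m"
    and K: "\<And>l m s. l \<in> {1..3} \<Longrightarrow> m \<in> {1..3} \<Longrightarrow> s \<in> {1, 2} \<Longrightarrow>
        a s * Z_coeff \<Omega> \<sigma> a lam \<kappa> l m + lam * d m s * cnj (e l) = aK_coeff \<Omega> \<sigma> a b lam \<kappa> s l m"
  shows "cfl_solution_on \<sigma> {(x, t). M1 \<Omega> \<sigma> a b lam \<kappa> c x t \<noteq> 0} (u1fold \<Omega> \<sigma> a b lam \<kappa> c)"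
proof -
  interpret plane_wave_modes \<sigma> lam a b "frequency \<sigma> a b" \<kappa> "\<lambda>m. mode_freq \<sigma> a b (1 / lam\<^sup>2) (\<kappa> m)" e c d "{1..3}"
    using assms(1) mode frequency_dispersion[of b _ \<sigma> a] assms(3,4)
    by unfold_locales auto
  let ?X = "\<lambda>l m x t. exp (cnj (vartheta b (z1 lam) \<kappa> l x t) + vartheta b (z1 lam) \<kappa> m x t)"
  \<comment> \<open>The gauge factor shared by all modes; it enters numerator and denominator alike
    as the nonzero \<open>cnj (g t) * g t\<close>.\<close>
  define g where "g t = exp (\<i> * gauge \<sigma> a b (1 / lam\<^sup>2) * of_real t)" for t :: real
  have g: "cnj (g t) * g t \<noteq> 0" for t by (simp add: g_def)
  have E: "E x t m = g t * exp (vartheta b (z1 lam) \<kappa> m x t)" for x t m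
    unfolding E_def g_def z1_def by (rule expwave_vartheta) (use assms(1) in simp)
  have EE: "cnj (E x t l) * E x t m = cnj (g t) * g t * ?X l m x t" for x t l m
    unfolding E by (simp add: exp_add exp_cnj mult_ac)
  have M: "M x t = cnj (g t) * g t * (al / lam) * M1 \<Omega> \<sigma> a b lam \<kappa> c x t" for x t
    unfolding M_eq M1_def sum_distrib_left EE
    by (intro sum.cong refl) (simp add: Z al_def)
  have numerator: "u x t s * M x t + al * v x t s * cnj (p x t)
      = cnj (g t) * g t * (al / lam) * a_times_N3 \<Omega> \<sigma> a b lam \<kappa> c s x t * exp (\<i> * of_real (omega \<sigma> a b s x t))"
    if s: "s \<in> {1, 2}" for x t s
  proof -
    have c1: "carrier_wave b (frequency \<sigma> a b) x t s = exp (\<i> * of_real (omega \<sigma> a b s x t))"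
      unfolding omega_eq[OF assms(3,4) s] expwave_def by (simp add: algebra_simps)
    have c2: "(a s * (lam * (cnj (e l) * e m) - lamc * herm \<sigma> (d l) (d m)) + al * d m s * cnj (e l))
          * cnj (c l) * c m * (cnj (g t) * g t * ?X l m x t)
        = cnj (g t) * g t * (al / lam) * (aK_coeff \<Omega> \<sigma> a b lam \<kappa> s l m * cnj (c l) * c m * ?X l m x t)"
      if lm: "l \<in> {1..3}" "m \<in> {1..3}" for l m
    proof -
      have "a s * (lam * (cnj (e l) * e m) - lamc * herm \<sigma> (d l) (d m)) + al * d m s * cnj (e l)
          = al / lam * aK_coeff \<Omega> \<sigma> a b lam \<kappa> s l m"
        unfolding Z[OF lm] K[OF lm s, symmetric] using assms(1) by (simp add: al_def field_simps)
      then show ?thesis by (simp only: mult_ac)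
    qed
    show ?thesis
      unfolding w_numerator_eq a_times_N3_eq sum_distrib_left EE
      by (rule arg_cong2[where f = times, OF _ c1]) (intro sum.cong refl c2)
  qed
  have M_nz: "M x t \<noteq> 0 \<longleftrightarrow> M1 \<Omega> \<sigma> a b lam \<kappa> c x t \<noteq> 0" for x t
    unfolding M using g[of t] assms(1,2) by (auto simp: al_def)
  have w: "w x t s = u1fold \<Omega> \<sigma> a b lam \<kappa> c s x t" if "s \<in> {1, 2}" for s x t
  proof -
    have "cnj (g t) * g t * (al / lam) \<noteq> 0" using g[of t] assms(1,2) by (auto simp: al_def)
    then show ?thesis
      unfolding w_def numerator[OF that] unfolding M u1fold_def by simp
  qed
  have "cfl_solution_on \<sigma> {(x, t). M x t \<noteq> 0} (\<lambda>s x t. w x t s)"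
    by (rule cfl_solution_on_w) (unfold M_nz, rule open_M1_nonzero)
  also have "?this \<longleftrightarrow> ?thesis"
    unfolding M_nz by (intro cfl_solution_on_cong w)
  finally show ?thesis .
qed

section \<open>Coefficients on pairs of modes\<close>

lemma char_root_cnj:
  assumes "char_root \<sigma> a b z \<kappa>"
  shows "char_root \<sigma> a b (cnj z) (cnj \<kappa>)"
proof -
  have nz: "cnj \<kappa> + of_real r \<noteq> 0" if "\<kappa> + of_real r \<noteq> 0" for r
  proof -
    have "cnj (\<kappa> + of_real r) \<noteq> 0" using that by (simp only: complex_cnj_zero_iff not_False_eq_True)
    then show ?thesis by simp
  qed
  let ?f = "\<lambda>z \<kappa> :: complex. \<kappa> / z - 2 + (a 1)\<^sup>2 * (b 1)\<^sup>2 / (\<kappa> + b 1) + \<sigma> * (a 2)\<^sup>2 * (b 2)\<^sup>2 / (\<kappa> + b 2)"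
  have "?f (cnj z) (cnj \<kappa>) = cnj (?f z \<kappa>)"
    by simp
  also have "?f z \<kappa> = 0"
    using assms unfolding char_root_def by blast
  finally have "?f (cnj z) (cnj \<kappa>) = 0"
    by simp
  moreover have "cnj \<kappa> + b 1 \<noteq> 0" "cnj \<kappa> + b 2 \<noteq> 0"
    using assms nz[of "b 1"] nz[of "b 2"] unfolding char_root_def by blast+
  ultimately show ?thesis
    unfolding char_root_def by blast
qed

text \<open>Conjugating the second equation changes only \<open>z\<close>, so
  \<open>\<kappa> / z = \<kappa> / cnj z\<close>. Consequently
  \<open>\<kappa> m = cnj (\<kappa> l)\<close> is possible only if both roots are
  \<open>0\<close>.\<close>

lemma char_root_eq_cnj:
  assumes "char_root \<sigma> a b z \<kappa>" "char_root \<sigma> a b z (cnj \<kappa>)" "z \<noteq> cnj z"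
  shows "\<kappa> = 0"
proof (rule ccontr)
  let ?R = "2 - ((a 1)\<^sup>2 * (b 1)\<^sup>2 / (\<kappa> + b 1) + \<sigma> * (a 2)\<^sup>2 * (b 2)\<^sup>2 / (\<kappa> + b 2))"
  assume "\<kappa> \<noteq> 0"
  have "\<kappa> / z = ?R" "\<kappa> / cnj z = ?R"
    using assms(1) char_root_cnj[OF assms(2)] by (simp_all add: char_root_def algebra_simps)
  then have "\<kappa> / z = \<kappa> / cnj z" by (rule trans[OF _ sym])
  with \<open>\<kappa> \<noteq> 0\<close> have "inverse z = inverse (cnj z)"
    by (simp add: divide_inverse)
  with assms(3) show False by simp
qed

text \<open>By partial fractions the factor \<open>\<mu> - cnj \<kappa>\<close> turns each summand
  into a difference of reciprocals; the two resulting sums are known from the characteristic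
  equations.\<close>

lemma herm_regular_mode:
  assumes "lam \<noteq> 0" "char_root \<sigma> a b (1 / lam\<^sup>2) \<kappa>" "char_root \<sigma> a b (1 / lam\<^sup>2) \<mu>"
  shows "cnj lam * lam * (\<mu> - cnj \<kappa>) * herm \<sigma> (regular_mode lam a b \<kappa>) (regular_mode lam a b \<mu>)
    = \<mu> * lam\<^sup>2 - cnj \<kappa> * (cnj lam)\<^sup>2"
proof -
  let ?k = "cnj \<kappa>"
  have k: "?k + b 1 \<noteq> 0" "?k + b 2 \<noteq> 0" and
    rk: "?k * (cnj lam)\<^sup>2 - 2 + (a 1)\<^sup>2 * (b 1)\<^sup>2 / (?k + b 1) + \<sigma> * (a 2)\<^sup>2 * (b 2)\<^sup>2 / (?k + b 2) = 0"
    using char_root_cnj[OF assms(2)] by (auto simp: char_root_def)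
  have m: "\<mu> + b 1 \<noteq> 0" "\<mu> + b 2 \<noteq> 0" and
    rm: "\<mu> * lam\<^sup>2 - 2 + (a 1)\<^sup>2 * (b 1)\<^sup>2 / (\<mu> + b 1) + \<sigma> * (a 2)\<^sup>2 * (b 2)\<^sup>2 / (\<mu> + b 2) = 0"
    using assms(3) by (auto simp: char_root_def)
  have *: "cnj lam * lam * (\<mu> - ?k) * (cnj (regular_mode lam a b \<kappa> s) * regular_mode lam a b \<mu> s)
    = (a s)\<^sup>2 * (b s)\<^sup>2 / (?k + b s) - (a s)\<^sup>2 * (b s)\<^sup>2 / (\<mu> + b s)" if "?k + b s \<noteq> 0" "\<mu> + b s \<noteq> 0" for s
    using that assms(1) by (simp add: regular_mode_def divide_simps power2_eq_square) algebra
  have "cnj lam * lam * (\<mu> - cnj \<kappa>) * herm \<sigma> (regular_mode lam a b \<kappa>) (regular_mode lam a b \<mu>)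
    = cnj lam * lam * (\<mu> - ?k) * (cnj (regular_mode lam a b \<kappa> 1) * regular_mode lam a b \<mu> 1)
    + \<sigma> * (cnj lam * lam * (\<mu> - ?k) * (cnj (regular_mode lam a b \<kappa> 2) * regular_mode lam a b \<mu> 2))"
    by (simp add: herm_def algebra_simps)
  also have "\<dots> = \<mu> * lam\<^sup>2 - ?k * (cnj lam)\<^sup>2"
    unfolding *[OF k(1) m(1)] *[OF k(2) m(2)] using rk rm by (simp add: algebra_simps)
  finally show ?thesis .
qed

lemma regular_Z_gen:
  assumes "lam \<noteq> 0" "char_root \<sigma> a b (1 / lam\<^sup>2) (\<kappa> l)" "char_root \<sigma> a b (1 / lam\<^sup>2) (\<kappa> m)"
    "\<kappa> m \<noteq> cnj (\<kappa> l)"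
  shows "lam - cnj lam * herm \<sigma> (regular_mode lam a b (\<kappa> l)) (regular_mode lam a b (\<kappa> m))
    = ((cnj lam)\<^sup>2 - lam\<^sup>2) / lam * Z_gen \<kappa> l m"
proof -
  have "cnj lam * herm \<sigma> (regular_mode lam a b (\<kappa> l)) (regular_mode lam a b (\<kappa> m))
    = (\<kappa> m * lam\<^sup>2 - cnj (\<kappa> l) * (cnj lam)\<^sup>2) / (lam * (\<kappa> m - cnj (\<kappa> l)))"
    using herm_regular_mode[OF assms(1-3)] assms(1,4) by (simp add: eq_divide_eq mult_ac)
  then show ?thesis
    using assms(1,4) by (simp add: Z_gen_def divide_simps power2_eq_square) algebra
qed

lemma regular_K_gen:
  assumes "lam \<noteq> 0" "\<kappa> m + b s \<noteq> 0" "\<kappa> m \<noteq> cnj (\<kappa> l)"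
  shows "a s * Z_gen \<kappa> l m + lam * regular_mode lam a b (\<kappa> m) s = a s * K_gen b \<kappa> s l m"
proof -
  have "\<kappa> m - cnj (\<kappa> l) \<noteq> 0" using assms(3) by simp
  then show ?thesis
    unfolding Z_gen_def regular_mode_def K_gen_def using assms(1,2)
    by (simp add: divide_simps) (simp add: algebra_simps)
qed

lemma zero_coeffs:
  assumes "lam \<noteq> 0" "(cnj lam)\<^sup>2 \<noteq> lam\<^sup>2"
  shows "Z_zero \<sigma> a (z1 lam) = (of_real ((a 1)\<^sup>2 + \<sigma> * (a 2)\<^sup>2) - lam\<^sup>2) / (lam\<^sup>2 - (cnj lam)\<^sup>2)"
    and "K_zero \<sigma> a (z1 lam) = (of_real ((a 1)\<^sup>2 + \<sigma> * (a 2)\<^sup>2) - (cnj lam)\<^sup>2) / (lam\<^sup>2 - (cnj lam)\<^sup>2)"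
proof -
  define S L Lc where "S = complex_of_real ((a 1)\<^sup>2 + \<sigma> * (a 2)\<^sup>2)" and "L = lam\<^sup>2" and "Lc = (cnj lam)\<^sup>2"
  have cL: "cnj L = Lc" by (simp add: L_def Lc_def)
  have nz: "L \<noteq> 0" "Lc \<noteq> 0" "L - Lc \<noteq> 0" using assms by (auto simp: L_def Lc_def)
  have n: "of_real ((cmod (z1 lam))\<^sup>2) = 1 / (L * Lc)"
    by (simp only: complex_norm_square) (simp add: z1_def L_def Lc_def)
  have den: "1 / (L * Lc) - (1 / L)\<^sup>2 = (L - Lc) / (L\<^sup>2 * Lc)"
    using nz by (simp add: field_simps power2_eq_square)
  have "1 / (L * Lc) * (S * (1 / L) - 1) / ((L - Lc) / (L\<^sup>2 * Lc)) = (S - L) / (L - Lc)"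
    using nz by (simp add: field_simps power2_eq_square)
  moreover have "(1 / L)\<^sup>2 * (S * (1 / Lc) - 1) / ((L - Lc) / (L\<^sup>2 * Lc)) = (S - Lc) / (L - Lc)"
    using nz by (simp add: field_simps power2_eq_square)
  ultimately show "Z_zero \<sigma> a (z1 lam) = (of_real ((a 1)\<^sup>2 + \<sigma> * (a 2)\<^sup>2) - lam\<^sup>2) / (lam\<^sup>2 - (cnj lam)\<^sup>2)"
    "K_zero \<sigma> a (z1 lam) = (of_real ((a 1)\<^sup>2 + \<sigma> * (a 2)\<^sup>2) - (cnj lam)\<^sup>2) / (lam\<^sup>2 - (cnj lam)\<^sup>2)"
    unfolding Z_zero_def K_zero_def n S_def[symmetric]
    by (simp_all add: z1_def cL L_def[symmetric] Lc_def[symmetric] den[unfolded power_one_over[symmetric]])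
qed

text \<open>At the root \<open>0\<close> the general entry would be \<open>0 / 0\<close>. But there
  \<open>regular_mode\<close> is just \<open>a s / lam\<close>, and the form can be evaluated
  directly.\<close>

lemma regular_Z_zero:
  assumes "lam \<noteq> 0" "(cnj lam)\<^sup>2 \<noteq> lam\<^sup>2" "b 1 \<noteq> 0" "b 2 \<noteq> 0"
  shows "lam - cnj lam * herm \<sigma> (regular_mode lam a b 0) (regular_mode lam a b 0)
    = ((cnj lam)\<^sup>2 - lam\<^sup>2) / lam * Z_zero \<sigma> a (z1 lam)"
proof -
  have h: "cnj lam * herm \<sigma> (regular_mode lam a b 0) (regular_mode lam a b 0) = of_real ((a 1)\<^sup>2 + \<sigma> * (a 2)\<^sup>2) / lam"
    using assms by (simp add: herm_def regular_mode_def field_simps power2_eq_square)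
  have "lam\<^sup>2 - (cnj lam)\<^sup>2 \<noteq> 0" using assms(2) by simp
  then show ?thesis
    unfolding h zero_coeffs[OF assms(1,2)] using assms(1)
    by (simp add: divide_simps power2_eq_square) algebra
qed

lemma regular_K_zero:
  assumes "lam \<noteq> 0" "(cnj lam)\<^sup>2 \<noteq> lam\<^sup>2" "b s \<noteq> 0"
  shows "a s * Z_zero \<sigma> a (z1 lam) + lam * regular_mode lam a b 0 s = a s * K_zero \<sigma> a (z1 lam)"
proof -
  have "lam\<^sup>2 - (cnj lam)\<^sup>2 \<noteq> 0" using assms(2) by simp
  then show ?thesis
    unfolding zero_coeffs[OF assms(1,2)] regular_mode_def using assms(1,3)
    by (simp add: divide_simps) (simp add: algebra_simps)
qed

lemma degenerate_ZK_33:
  assumes "lam \<noteq> 0" "(cnj lam)\<^sup>2 \<noteq> lam\<^sup>2" "\<sigma>\<^sup>2 = 1"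
  shows "- cnj lam * herm \<sigma> (degenerate_mode \<sigma> a) (degenerate_mode \<sigma> a)
    = ((cnj lam)\<^sup>2 - lam\<^sup>2) / lam * ZK_33 \<sigma> a (z1 lam)"
proof -
  define L Lc where "L = lam\<^sup>2" and "Lc = (cnj lam)\<^sup>2"
  have cL: "cnj L = Lc" by (simp add: L_def Lc_def)
  have nz: "L \<noteq> 0" "Lc \<noteq> 0" "L - Lc \<noteq> 0" using assms by (auto simp: L_def Lc_def)
  define S where "S = complex_of_real (\<sigma> + (a 2)\<^sup>2 / (a 1)\<^sup>2)"
  have "herm \<sigma> (degenerate_mode \<sigma> a) (degenerate_mode \<sigma> a) = of_real (\<sigma>\<^sup>2 * (a 2)\<^sup>2 / (a 1)\<^sup>2 + \<sigma>)"
    by (simp add: herm_def degenerate_mode_def power2_eq_square)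
  then have h: "herm \<sigma> (degenerate_mode \<sigma> a) (degenerate_mode \<sigma> a) = S"
    unfolding assms(3) S_def by (simp add: add.commute)
  have "complex_of_real (cmod (z1 lam)) = 1 / (lam * cnj lam)"
    unfolding z1_def complex_norm_square[symmetric] by (simp add: norm_divide norm_power)
  moreover have "cnj (z1 lam) - z1 lam = (L - Lc) / (L * Lc)"
    using nz by (simp add: z1_def cL L_def[symmetric] Lc_def[symmetric] field_simps)
  ultimately have "ZK_33 \<sigma> a (z1 lam) = S * (1 / (lam * cnj lam)) / ((L - Lc) / (L * Lc))"
    by (simp add: ZK_33_def S_def)
  also have "\<dots> = S * lam * cnj lam / (L - Lc)"
    using assms(1) nz by (simp add: field_simps) (simp add: L_def Lc_def power2_eq_square)
  finally show ?thesis
    unfolding h L_def[symmetric] Lc_def[symmetric] using nz assms(1) by (simp add: field_simps)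
qed

text \<open>For equal \<open>b\<close> the regular vector is parallel to \<open>a\<close>, to which
  the degenerate one is orthogonal. Hence the vanishing \<open>Z\<close>-entries with exactly one
  index 3.\<close>

lemma herm_regular_degenerate:
  assumes "b 1 = b 2" "a 1 \<noteq> 0"
  shows "herm \<sigma> (regular_mode lam a b \<kappa>) (degenerate_mode \<sigma> a) = 0"
    and "herm \<sigma> (degenerate_mode \<sigma> a) (regular_mode lam a b \<kappa>) = 0"
  using assms by (simp_all add: herm_def regular_mode_def degenerate_mode_def)

section \<open>Roots of the quadratic and the cubic\<close>

text \<open>At \<open>- b 1\<close> the quadratic takes the value
  \<open>((a 1)^2 + \<sigma> * (a 2)^2) * (b 1)^2\<close>, nonzero by assumption, so division by
  \<open>\<kappa> + b 1\<close> is legitimate.\<close>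

lemma char_root_of_quad:
  assumes "\<kappa> \<in># proots (quad_poly \<sigma> a b z)" "b 1 = b 2" "b 1 \<noteq> 0" "(a 1)\<^sup>2 + \<sigma> * (a 2)\<^sup>2 \<noteq> 0"
  shows "char_root \<sigma> a b z \<kappa>"
proof -
  \<comment> \<open>The zero polynomial has the empty multiset as \<open>proots\<close>.\<close>
  have "quad_poly \<sigma> a b z \<noteq> 0" using assms(1) by auto
  then have "poly (quad_poly \<sigma> a b z) \<kappa> = 0" using assms(1) by simp
  then have r: "(\<kappa> / z - 2) * (\<kappa> + b 1) + of_real (((a 1)\<^sup>2 + \<sigma> * (a 2)\<^sup>2) * (b 1)\<^sup>2) = 0"
    by (simp add: quad_poly_def algebra_simps add_divide_distrib)
  have k: "\<kappa> + b 1 \<noteq> 0"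
  proof
    assume "\<kappa> + b 1 = 0"
    with r have "((a 1)\<^sup>2 + \<sigma> * (a 2)\<^sup>2) * (b 1)\<^sup>2 = 0"
      unfolding of_real_eq_0_iff[symmetric, where 'a = complex] by simp
    with assms(3,4) show False by simp
  qed
  have "((\<kappa> / z - 2) * (\<kappa> + b 1) + of_real (((a 1)\<^sup>2 + \<sigma> * (a 2)\<^sup>2) * (b 1)\<^sup>2)) / (\<kappa> + b 1)
    = \<kappa> / z - 2 + (a 1)\<^sup>2 * (b 1)\<^sup>2 / (\<kappa> + b 1) + \<sigma> * (a 2)\<^sup>2 * (b 1)\<^sup>2 / (\<kappa> + b 1)"
    using k by (simp add: add_divide_distrib distrib_right)
  then show ?thesis
    unfolding r char_root_def using k assms(2) by simp
qed

text \<open>At \<open>- b 1\<close> only the term \<open>(a 1)^2 * (b 1)^2 * (b 2 - b 1)\<close> of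
  the cubic survives, and similarly at \<open>- b 2\<close>; neither vanishes.\<close>

lemma char_root_of_cubic:
  assumes "\<kappa> \<in># proots (cubic_poly \<sigma> a b z)" "b 1 \<noteq> b 2" "b 1 \<noteq> 0" "b 2 \<noteq> 0" "a 1 \<noteq> 0" "a 2 \<noteq> 0" "\<sigma> \<noteq> 0"
  shows "char_root \<sigma> a b z \<kappa>"
proof -
  let ?r = "(\<kappa> / z - 2) * (\<kappa> + b 1) * (\<kappa> + b 2)
    + of_real ((a 1)\<^sup>2 * (b 1)\<^sup>2) * (\<kappa> + b 2) + of_real (\<sigma> * (a 2)\<^sup>2 * (b 2)\<^sup>2) * (\<kappa> + b 1)"
  have "cubic_poly \<sigma> a b z \<noteq> 0" using assms(1) by auto
  then have "poly (cubic_poly \<sigma> a b z) \<kappa> = 0" using assms(1) by simp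
  then have r: "?r = 0"
    by (simp add: cubic_poly_def algebra_simps add_divide_distrib)
  have k1: "\<kappa> + b 1 \<noteq> 0"
  proof
    assume "\<kappa> + b 1 = 0"
    with r assms(3,5) have "\<kappa> + b 2 = 0" by simp
    with \<open>\<kappa> + b 1 = 0\<close> have "complex_of_real (b 1) = of_real (b 2)" by (metis add_left_cancel)
    with assms(2) show False by simp
  qed
  have k2: "\<kappa> + b 2 \<noteq> 0"
  proof
    assume "\<kappa> + b 2 = 0"
    with r assms(4,6,7) have "\<kappa> + b 1 = 0" by simp
    with k1 show False ..
  qed
  have "?r / ((\<kappa> + b 1) * (\<kappa> + b 2))
    = \<kappa> / z - 2 + (a 1)\<^sup>2 * (b 1)\<^sup>2 / (\<kappa> + b 1) + \<sigma> * (a 2)\<^sup>2 * (b 2)\<^sup>2 / (\<kappa> + b 2)"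
    using k1 k2 by (simp add: add_divide_distrib)
  then show ?thesis
    unfolding r char_root_def using k1 k2 by simp
qed

text \<open>At \<open>0\<close> the parameter \<open>z\<close> drops out and a real condition
  remains. It holds on \<open>Omega1\<close> and \<open>Omega3\<close> and fails on
  \<open>Omega2\<close> and \<open>Omega4\<close>.\<close>

lemma char_root_zero_iff:
  assumes "b 1 \<noteq> 0" "b 2 \<noteq> 0"
  shows "char_root \<sigma> a b z 0 \<longleftrightarrow> (a 1)\<^sup>2 * b 1 + \<sigma> * (a 2)\<^sup>2 * b 2 = 2"
proof -
  have "complex_of_real ((a 1)\<^sup>2 * (b 1)\<^sup>2) / (0 + b 1) + of_real (\<sigma> * (a 2)\<^sup>2 * (b 2)\<^sup>2) / (0 + b 2)
    = of_real ((a 1)\<^sup>2 * b 1 + \<sigma> * (a 2)\<^sup>2 * b 2)"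
    using assms by (simp add: power2_eq_square)
  then have "char_root \<sigma> a b z 0 \<longleftrightarrow> complex_of_real ((a 1)\<^sup>2 * b 1 + \<sigma> * (a 2)\<^sup>2 * b 2 - 2) = of_real 0"
    unfolding char_root_def using assms by (simp add: add.assoc) (simp add: algebra_simps)
  then show ?thesis
    unfolding of_real_eq_iff by simp
qed

text \<open>A double root at \<open>0\<close> would annihilate the linear coefficient, whose only
  non-real term is \<open>b 1 * b 2 / z\<close>.\<close>

lemma cubic_simple_zero_root:
  assumes "proots (cubic_poly \<sigma> a b z) = {#k1, k2, 0#}" "b 1 \<noteq> 0" "b 2 \<noteq> 0" "z \<noteq> cnj z"
  shows "k1 \<noteq> 0" "k2 \<noteq> 0"
proof -
  let ?p = "cubic_poly \<sigma> a b z"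
  have p: "?p \<noteq> 0" using assms(1) by auto
  have "order 0 ?p < 2"
  proof (rule ccontr)
    assume "\<not> order 0 ?p < 2"
    then have "[:0, 1:]\<^sup>2 dvd ?p"
      using order_divides[of 0 2 ?p] by simp
    then obtain q where q: "?p = [:0, 1:]\<^sup>2 * q" by (elim dvdE)
    have "poly (pderiv ?p) 0 = 0"
      unfolding q by (simp add: pderiv_mult power2_eq_square pderiv_pCons)
    then have "b 1 * b 2 / z = of_real (2 * (b 1 + b 2) - (a 1)\<^sup>2 * (b 1)\<^sup>2 - \<sigma> * (a 2)\<^sup>2 * (b 2)\<^sup>2)"
      by (simp add: cubic_poly_def pderiv_mult pderiv_add pderiv_smult pderiv_pCons algebra_simps)
    then have "cnj (b 1 * b 2 / z) = b 1 * b 2 / z"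
      by (simp only: complex_cnj_complex_of_real)
    then have "inverse (cnj z) = inverse z"
      using assms(2,3) by (simp add: divide_inverse)
    with assms(4) show False by simp
  qed
  then have "count {#k1, k2, 0#} 0 < 2"
    using p unfolding assms(1)[symmetric] by simp
  then show "k1 \<noteq> 0" "k2 \<noteq> 0" by (auto split: if_splits)
qed

section \<open>Assembly by parameter class\<close>

theorem mainTheorem11:
  fixes \<sigma> :: real and a b :: "nat \<Rightarrow> real" and lam :: complex
    and \<kappa> c :: "nat \<Rightarrow> complex" and \<Omega> :: param_class
  assumes "\<sigma> = 1 \<or> \<sigma> = -1"
    and "b 1 \<noteq> 0" and "b 2 \<noteq> 0"
    and "lam \<notin> \<real>" and "lam \<notin> range (\<lambda>y::real. \<i> * of_real y)"
    and "in_class \<Omega> \<sigma> a b"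
    and "\<Omega> = Omega1 \<Longrightarrow> a 2 \<noteq> 0"
    and "\<Omega> = Omega2 \<Longrightarrow> (a 1)\<^sup>2 + \<sigma> * (a 2)\<^sup>2 \<noteq> 0"
    and "\<Omega> = Omega3 \<Longrightarrow> b 1 \<noteq> b 2"
    and "admissible_kappa \<Omega> \<sigma> a b (z1 lam) \<kappa>"
  shows "cfl_solution_on \<sigma> {(x, t). M1 \<Omega> \<sigma> a b lam \<kappa> c x t \<noteq> 0}
           (u1fold \<Omega> \<sigma> a b lam \<kappa> c)"
proof -
  have lam: "lam \<noteq> 0" using assms(4) by auto
  \<comment> \<open>Off both axes \<open>lam^2\<close> is not real; this makes the Darboux factor
    \<open>al\<close> nonzero and \<open>z1 lam\<close> non-real.\<close>
  have lam2: "(cnj lam)\<^sup>2 \<noteq> lam\<^sup>2"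
  proof
    assume "(cnj lam)\<^sup>2 = lam\<^sup>2"
    then have "cnj lam = lam \<or> cnj lam = - lam" by (simp add: power2_eq_iff)
    then show False
    proof
      assume "cnj lam = lam"
      then show False using assms(4) by (simp add: Reals_cnj_iff)
    next
      assume "cnj lam = - lam"
      then have "Re lam = 0" by (simp add: complex_eq_iff)
      then have "lam = \<i> * of_real (Im lam)" by (simp add: complex_eq_iff)
      then show False using assms(5) by blast
    qed
  qed
  have z1: "1 / lam\<^sup>2 = z1 lam" by (simp add: z1_def)
  have z: "z1 lam \<noteq> cnj (z1 lam)"
    using lam lam2 by (auto simp: z1_def)
  have zz: "1 / lam\<^sup>2 \<noteq> cnj (1 / lam\<^sup>2)" unfolding z1 by (rule z)
  have \<sigma>2: "\<sigma>\<^sup>2 = 1" and \<sigma>0: "\<sigma> \<noteq> 0" using assms(1) by auto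
  note kap = assms(10)[unfolded admissible_kappa_def]
  have I: "m = 1 \<or> m = 2 \<or> m = 3" if "m \<in> {1..3}" for m :: nat using that by auto
  note eq_cnj = char_root_eq_cnj[OF _ _ zz]
  \<comment> \<open>Equal \<open>b\<close>: two regular modes and the degenerate one.
    \<open>S\<close> keeps the roots off the pole \<open>- b 1\<close>; the condition on
    \<open>\<Omega>\<close> tells whether \<open>0\<close> is a root.\<close>
  have eqb: ?thesis
    if b: "b 1 = b 2" and a1: "a 1 \<noteq> 0" and S: "(a 1)\<^sup>2 + \<sigma> * (a 2)\<^sup>2 \<noteq> 0"
      and \<Omega>: "\<Omega> = Omega1 \<or> \<Omega> = Omega2 \<and> (a 1)\<^sup>2 * b 1 + \<sigma> * (a 2)\<^sup>2 * b 2 \<noteq> 2"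
  proof -
    have r: "char_root \<sigma> a b (1 / lam\<^sup>2) (\<kappa> m)" if "m \<in> {1, 2}" for m
      unfolding z1 using that kap b S assms(2) by (intro char_root_of_quad) auto
    have k3: "\<kappa> 3 = - of_real (b 1)" using kap b by simp
    have ne: "\<kappa> m \<noteq> cnj (\<kappa> l)" if "l \<in> {1, 2}" "m \<in> {1, 2}" "\<Omega> = Omega1 \<Longrightarrow> l + m < 4" for l m
    proof
      assume e: "\<kappa> m = cnj (\<kappa> l)"
      then have l0: "\<kappa> l = 0" by (intro eq_cnj[OF r[OF that(1)] r[OF that(2), unfolded e]])
      with e have m0: "\<kappa> m = 0" by simp
      show False
      proof (cases "\<Omega> = Omega1")
        case True
        \<comment> \<open>By \<open>l + m < 4\<close> one of the indices is 1, whereas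
          \<open>\<kappa> 1 = 2 * z1 lam - b 1\<close> is not real.\<close>
        then have "\<kappa> 1 = 0" using that l0 m0 by auto
        then have "2 * z1 lam = of_real (b 1)" using kap True by simp
        then have "cnj (2 * z1 lam) = 2 * z1 lam" by (simp only: complex_cnj_complex_of_real)
        with z show False by simp
      next
        case False
        with \<Omega> r[OF that(1)] l0 show False
          using char_root_zero_iff[of b] assms(2,3) by simp
      qed
    qed
    let ?e = "\<lambda>m::nat. if m = 3 then 0 else 1 :: complex"
    let ?d = "\<lambda>m. if m = 3 then degenerate_mode \<sigma> a else regular_mode lam a b (\<kappa> m)"
    show ?thesis
    proof (rule cfl_solution_on_u1fold[where e = ?e and d = ?d])
      fix m :: nat assume m: "m \<in> {1..3}"
      show "lax_mode \<sigma> lam a b (frequency \<sigma> a b) (\<kappa> m) (mode_freq \<sigma> a b (1 / lam\<^sup>2) (\<kappa> m)) (?e m) (?d m)"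
      proof (cases "m = 3")
        case True
        then show ?thesis using lax_mode_degenerate[of lam b a, OF lam assms(2) b a1, of \<sigma>] k3 by simp
      next
        case False
        then have "m \<in> {1, 2}" using I[OF m] by simp
        then show ?thesis using False lax_mode_regular[OF lam assms(2,3) r] by simp
      qed
      fix l :: nat assume l: "l \<in> {1..3}"
      have Z: "Z_coeff \<Omega> \<sigma> a lam \<kappa> l m =
          (if l = 3 \<and> m = 3 then ZK_33 \<sigma> a (z1 lam) else if l = 3 \<or> m = 3 then 0
           else if \<Omega> = Omega1 \<and> l = 2 \<and> m = 2 then Z_zero \<sigma> a (z1 lam) else Z_gen \<kappa> l m)"
        using I[OF l] I[OF m] \<Omega> by auto
      have regular: "char_root \<sigma> a b (1 / lam\<^sup>2) (\<kappa> l)" "char_root \<sigma> a b (1 / lam\<^sup>2) (\<kappa> m)"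
        "\<kappa> m \<noteq> cnj (\<kappa> l) \<or> \<Omega> = Omega1 \<and> l = 2 \<and> m = 2" if "l \<noteq> 3" "m \<noteq> 3"
      proof -
        have "l \<in> {1, 2}" "m \<in> {1, 2}" using I[OF l] I[OF m] that by auto
        then show "char_root \<sigma> a b (1 / lam\<^sup>2) (\<kappa> l)" "char_root \<sigma> a b (1 / lam\<^sup>2) (\<kappa> m)"
          "\<kappa> m \<noteq> cnj (\<kappa> l) \<or> \<Omega> = Omega1 \<and> l = 2 \<and> m = 2"
          using r ne[of l m] by auto
      qed
      have k2: "\<kappa> 2 = 0" if "\<Omega> = Omega1" using kap that by simp
      show "lam * (cnj (?e l) * ?e m) - cnj lam * herm \<sigma> (?d l) (?d m)
          = ((cnj lam)\<^sup>2 - lam\<^sup>2) / lam * Z_coeff \<Omega> \<sigma> a lam \<kappa> l m"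
      proof -
        consider "l = 3 \<or> m = 3" | "\<Omega> = Omega1" "l = 2" "m = 2" 
          | "l \<noteq> 3" "m \<noteq> 3" "\<not> (\<Omega> = Omega1 \<and> l = 2 \<and> m = 2)" by blast
        then show ?thesis
        proof cases
          case 1
          then show ?thesis
            unfolding Z using degenerate_ZK_33[OF lam lam2 \<sigma>2, of a] herm_regular_degenerate[of b a, OF b a1] by auto
        next
          case 2
          then show ?thesis
            unfolding Z using regular_Z_zero[OF lam lam2 assms(2,3), of \<sigma> a] k2 by simp
        next
          case 3
          with regular(3) have "\<kappa> m \<noteq> cnj (\<kappa> l)" by blast
          from regular_Z_gen[OF lam regular(1,2)[OF 3(1,2)] this] 3 show ?thesis
            unfolding Z by auto
        qed
      qed
      fix s :: nat assume s: "s \<in> {1, 2}"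
      have K_coeff: "K_coeff \<Omega> \<sigma> a b lam \<kappa> s l m =
          (if l = 3 \<and> m = 3 then ZK_33 \<sigma> a (z1 lam) else if l = 3 then 0 else if m = 3 then K_l3 \<sigma> a lam s
           else if \<Omega> = Omega1 \<and> l = 2 \<and> m = 2 then K_zero \<sigma> a (z1 lam) else K_gen b \<kappa> 1 l m)"
        using I[OF l] I[OF m] \<Omega> by auto
      have K_gen: "K_gen b \<kappa> 1 l m = K_gen b \<kappa> s l m"
        using s b by (auto simp: K_gen_def)
      \<comment> \<open>For \<open>a 2 = 0\<close> the entry \<open>lam / a 2\<close> defaults to
        \<open>0\<close>, so the intended product \<open>lam\<close> has to be supplied
        separately.\<close>
      have K_l3: "lam * degenerate_mode \<sigma> a s = (if s = 2 \<and> a 2 = 0 then lam else a s * K_l3 \<sigma> a lam s)"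
        using s a1 by (auto simp: K_l3_def degenerate_mode_def power2_eq_square)
      have K: "aK_coeff \<Omega> \<sigma> a b lam \<kappa> s l m =
          (if l = 3 \<and> m = 3 then a s * ZK_33 \<sigma> a (z1 lam) else if l = 3 then 0
           else if m = 3 then lam * degenerate_mode \<sigma> a s
           else a s * (if \<Omega> = Omega1 \<and> l = 2 \<and> m = 2 then K_zero \<sigma> a (z1 lam) else K_gen b \<kappa> s l m))"
        unfolding aK_coeff_def K_coeff K_gen K_l3 using I[OF l] by (cases "s = 2 \<and> a 2 = 0") auto
      show "a s * Z_coeff \<Omega> \<sigma> a lam \<kappa> l m + lam * ?d m s * cnj (?e l) = aK_coeff \<Omega> \<sigma> a b lam \<kappa> s l m"
      proof -
        consider "l = 3 \<or> m = 3" | "\<Omega> = Omega1" "l = 2" "m = 2" 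
          | "l \<noteq> 3" "m \<noteq> 3" "\<not> (\<Omega> = Omega1 \<and> l = 2 \<and> m = 2)" by blast
        then show ?thesis
        proof cases
          case 1
          then show ?thesis unfolding Z K by auto
        next
          case 2
          have "b s \<noteq> 0" using s assms(2,3) by auto
          from regular_K_zero[of lam b s a, OF lam lam2 this] 2 k2 show ?thesis
            unfolding Z K by simp
        next
          case 3
          with regular(3) have ne: "\<kappa> m \<noteq> cnj (\<kappa> l)" by blast
          have "\<kappa> m + b s \<noteq> 0" using s regular(2)[OF 3(1,2)] by (auto simp: char_root_def)
          from regular_K_gen[of lam \<kappa> m b s l a, OF lam this ne] show ?thesis
            unfolding Z K if_not_P[OF 3(3)] using 3(1,2) by simp
        qed
      qed
    qed (use lam lam2 assms(2,3) in auto)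
  qed
  \<comment> \<open>Distinct \<open>b\<close>: all three roots give regular modes.\<close>
  have neb: ?thesis
    if b: "b 1 \<noteq> b 2" and a: "a 1 \<noteq> 0" "a 2 \<noteq> 0"
      and \<Omega>: "\<Omega> = Omega3 \<or> \<Omega> = Omega4 \<and> (a 1)\<^sup>2 * b 1 + \<sigma> * (a 2)\<^sup>2 * b 2 \<noteq> 2"
  proof -
    have proots: "proots (cubic_poly \<sigma> a b (z1 lam)) = {#\<kappa> 1, \<kappa> 2, \<kappa> 3#}" using kap b a by blast
    have r: "char_root \<sigma> a b (1 / lam\<^sup>2) (\<kappa> m)" if "m \<in> {1..3}" for m
      unfolding z1 using I[OF that] b a \<sigma>0 assms(2,3) by (intro char_root_of_cubic) (auto simp: proots)
    have ne: "\<kappa> m \<noteq> cnj (\<kappa> l)" if lm: "l \<in> {1..3}" "m \<in> {1..3}" "\<not> (\<Omega> = Omega3 \<and> l = 3 \<and> m = 3)" for l m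
    proof
      assume e: "\<kappa> m = cnj (\<kappa> l)"
      then have l0: "\<kappa> l = 0" by (intro eq_cnj[OF r[OF that(1)] r[OF that(2), unfolded e]])
      with e have m0: "\<kappa> m = 0" by simp
      show False
      proof (cases "\<Omega> = Omega3")
        case True
        then have "\<kappa> 3 = 0" using kap by simp
        \<comment> \<open>The root \<open>0\<close> is simple, so only the entry (3,3) needs the
          special formula.\<close>
        then have "\<kappa> 1 \<noteq> 0" "\<kappa> 2 \<noteq> 0"
          using cubic_simple_zero_root[of \<sigma> a b "z1 lam" "\<kappa> 1" "\<kappa> 2"] assms(2,3) z proots by auto
        then show False using I[OF lm(1)] I[OF lm(2)] lm(3) l0 m0 True by auto
      next
        case False
        with \<Omega> r[OF that(1)] l0 show False
          using char_root_zero_iff[of b] assms(2,3) by simp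
      qed
    qed
    let ?d = "\<lambda>m. regular_mode lam a b (\<kappa> m)"
    show ?thesis
    proof (rule cfl_solution_on_u1fold[where e = "\<lambda>m. 1" and d = ?d])
      fix m :: nat assume m: "m \<in> {1..3}"
      show "lax_mode \<sigma> lam a b (frequency \<sigma> a b) (\<kappa> m) (mode_freq \<sigma> a b (1 / lam\<^sup>2) (\<kappa> m)) 1 (?d m)"
        by (rule lax_mode_regular[OF lam assms(2,3) r[OF m]])
      fix l :: nat assume l: "l \<in> {1..3}"
      have Z: "Z_coeff \<Omega> \<sigma> a lam \<kappa> l m = (if \<Omega> = Omega3 \<and> l = 3 \<and> m = 3 then Z_zero \<sigma> a (z1 lam) else Z_gen \<kappa> l m)"
        using \<Omega> by auto
      have k3: "\<kappa> 3 = 0" if "\<Omega> = Omega3" using kap that by simp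
      show "lam * (cnj 1 * 1) - cnj lam * herm \<sigma> (?d l) (?d m)
          = ((cnj lam)\<^sup>2 - lam\<^sup>2) / lam * Z_coeff \<Omega> \<sigma> a lam \<kappa> l m"
        unfolding Z
        using regular_Z_zero[OF lam lam2 assms(2,3)] regular_Z_gen[OF lam r[OF l] r[OF m]] ne[OF l m] k3
        by auto
      fix s :: nat assume s: "s \<in> {1, 2}"
      have K: "aK_coeff \<Omega> \<sigma> a b lam \<kappa> s l m = a s * (if \<Omega> = Omega3 \<and> l = 3 \<and> m = 3 then K_zero \<sigma> a (z1 lam) else K_gen b \<kappa> s l m)"
        using \<Omega> a by (auto simp: aK_coeff_def)
      have bs: "b s \<noteq> 0" "\<kappa> m + b s \<noteq> 0"
        using s assms(2,3) r[OF m] by (auto simp: char_root_def)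
      show "a s * Z_coeff \<Omega> \<sigma> a lam \<kappa> l m + lam * ?d m s * cnj 1 = aK_coeff \<Omega> \<sigma> a b lam \<kappa> s l m"
        unfolding Z K
        using regular_K_zero[of lam b s a, OF lam lam2 bs(1)] regular_K_gen[of lam \<kappa> m b s l a, OF lam bs(2)] ne[OF l m] k3
        by auto
    qed (use lam lam2 assms(2,3) in auto)
  qed
  show ?thesis
  proof (cases \<Omega>)
    case Omega1
    \<comment> \<open>Here \<open>(a 1)^2 + \<sigma> * (a 2)^2 = 2 / b 1\<close>, which cannot
      vanish.\<close>
    then show ?thesis using assms(2,6) by (intro eqb) auto
  next
    case Omega2
    have "2 \<noteq> ((a 1)\<^sup>2 + \<sigma> * (a 2)\<^sup>2) * b 1" if "2 * b 1 - ((a 1)\<^sup>2 + \<sigma> * (a 2)\<^sup>2) * (b 1)\<^sup>2 \<noteq> 0"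
      using that by (auto simp: power2_eq_square)
    then show ?thesis using Omega2 assms(2,6,8) by (intro eqb) (auto simp: algebra_simps)
  next
    case Omega3
    then show ?thesis using assms(6,9) by (intro neb) auto
  next
    case Omega4
    have "(a 1)\<^sup>2 * b 1 + \<sigma> * (a 2)\<^sup>2 * b 2 \<noteq> 2"
    proof
      assume "(a 1)\<^sup>2 * b 1 + \<sigma> * (a 2)\<^sup>2 * b 2 = 2"
      then have "\<sigma> * b 2 = 2 / (a 2)\<^sup>2 - b 1 * (a 1)\<^sup>2 / (a 2)\<^sup>2"
        using Omega4 assms(6) by (simp add: field_simps)
      then show False using Omega4 assms(6) by simp
    qed
    then show ?thesis using Omega4 assms(6) by (intro neb) auto
  qed
qed

end
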